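(* Let $\exists\underline{e}\,\phi(\underline{e},\underline{y})$ be a primitive $\underline{e}$-flat formula. Suppose the algorithm described below, on input $\exists\underline{e}\,\phi(\underline{e},\underline{y})$, outputs the quantifier-free formula $\psi(\underline{y})$. Then $\psi(\underline{y})$ is a cover of $\exists\underline{e}\,\phi(\underline{e},\underline{y})$ with respect to the empty theory (pure equality with uninterpreted function symbols, EUF).
   Context: Signature $\Sigma$ with function symbols of arbitrary arity (relations encoded as $R(t_1,\dots,t_n)=\mathit{true}$). A quantifier-free $\psi(\underline{y})$ is a cover (w.r.t. theory $T$, here empty) of $\exists\underline{e}\,\phi$ iff $T\models\phi(\underline{e},\underline{y})\to\psi(\underline{y})$ and $T\models \psi(\underline{y})\to\theta(\underline{y},\underline{z})$ for every quantifier-free $\theta$ with $T\models\phi(\underline{e},\underline{y})\to\theta(\underline{y},\underline{z})$. The variables $\underline{e}=e_1,\dots,e_n$, $\underline{y}=y_1,\dots,y_m$ are treated as free constants. A term is $\underline{e}$-free iff no $e_i$ occurs in it; an $\underline{e}$-flat term is an $\underline{e}$-free term, some $e_i$, or $f(u_1,\dots,u_k)$ with each $u_i$ $\underline{e}$-free or among the $\underline{e}$; an $\underline{e}$-flat literal is $t=a$ or $a\neq b$ with $t$ $\underline{e}$-flat and $a,b$ each $\underline{e}$-free or among the $\underline{e}$; $\phi$ is a conjunction of such literals. Equalities are unordered. Fix a reduction ordering $>$, total on ground terms, such that $t=a$ is oriented $t>a$ whenever (i) $t$ is not $\underline{e}$-free and $a$ is $\underline{e}$-free, or (ii) $t$ is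 not $\underline{e}$-free, not one of the $e_i$, and $a$ is one of the $e_i$. $E(t,u)$ for $\underline{e}$-flat $t,u$: fails if exactly one is $\underline{e}$-free; fails if $t\equiv e_i$ and ($u\equiv f(\dots)$ or $u\equiv e_j$, $j\ne i$), and symmetrically; is $\emptyset$ if $t\equiv u$; is $\{t=u\}$ if $t\not\equiv u$ both $\underline{e}$-free; fails if neither is $\underline{e}$-free and head symbols differ; is $\bigcup_iE(t_i,u_i)$ if $t\equiv f(t_1,..,t_k)$, $u\equiv f(u_1,..,u_k)$ are not $\underline{e}$-free and no $E(t_i,u_i)$ fails. A constrained literal $L\,\Vert\,C$ ($L$ ground flat literal, $C$ finite set of ground equalities between $\underline{e}$-free terms) means $\bigwedge C\to L$. Rules (applicable only if the called $E$ does not fail): Superposition Right: from $l=r\Vert C$, $s=t\Vert D$ with $l>r$, $s>t$ infer $s[r]_p=t\Vert C\cup D\cup E(s_{|p},l)$; Superposition Left: from $l=r\Vert C$, $s\neq t\Vert D$ with $l>r,s>t$ infer $s[r]_p\neq t\Vert C\cup D\cup E(s_{|p},l)$; Reflexion: from $t\neq u\Vert C$ infer $\bot\Vert C\cup E(t,u)$; Demodulation: from $L\Vert C$ and $l=r\Vert D$ with $l>r$, $L_{|p}\equiv l$, $C\supseteq D$, add $L[r]_p\Vert C$ and remove $L\Vert C$. Policy: inference rules are not applied when a premise is $\underline{e}$-free; Demodulation only with second premise of form $e_j=t(\underline{y})\Vert D$, $t$ $\underline{e}$-free; Demodulation has priority over inferences; among Demodulations, priority to those with both premises of form $e_j=t(\underline{y})\Vert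 D$; if $e_j=t_1(\underline{y})\Vert D$ and $e_j=t_2(\underline{y})\Vert D$ both occur, the Demodulation keeping the smaller $t_i$ is applied. The algorithm starts from $\{L\Vert\emptyset\mid L$ a literal of $\phi\}$, applies rules until a saturated set $S$ is reached (every constrained literal producible by an inference rule, after exhaustive Demodulation, is already in $S$), and outputs the conjunction of the clauses $\bigwedge C\to L$ over all $\underline{e}$-free constrained literals $L\Vert C$ in $S$ (with $\bot$ read as false, and $e_i,y_j$ read back as variables). *)

theory Defs
  imports Main "HOL-Library.Uprod" "HOL-Library.Infinite_Typeclass"
begin

section \<open>Terms, quantifier-free formulas and their semantics\<close>

text \<open>
  A signature is a partial function assigning an arity to each of its function symbols.
  The variables \<open>e\<close> and \<open>y\<close> serve both as variables (in formulas) and as free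
  constants (in the calculus): the ground terms of the calculus are the terms whose variables all
  lie in \<open>e \<union> y\<close>.
\<close>

type_synonym 'f signature = "'f \<Rightarrow> nat option"

datatype ('f, vars: 'v) trm = Var 'v | Fun 'f "('f, 'v) trm list"

fun wf_trm :: "'f signature \<Rightarrow> ('f, 'v) trm \<Rightarrow> bool" where
  "wf_trm \<Sigma> (Var x) \<longleftrightarrow> True"
| "wf_trm \<Sigma> (Fun f ts) \<longleftrightarrow> \<Sigma> f = Some (length ts) \<and> (\<forall>t \<in> set ts. wf_trm \<Sigma> t)"

text \<open>Equalities are unordered pairs of terms.\<close>

type_synonym ('f, 'v) eqn = "('f, 'v) trm uprod"

definition vars_eqn :: "('f, 'v) eqn \<Rightarrow> 'v set" where
  "vars_eqn q = (\<Union>t \<in> set_uprod q. vars t)"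

datatype ('f, 'v) qf =
    TT
  | FF
  | Atom "('f, 'v) eqn"
  | Neg "('f, 'v) qf"
  | And "('f, 'v) qf" "('f, 'v) qf"
  | Or "('f, 'v) qf" "('f, 'v) qf"
  | Imp "('f, 'v) qf" "('f, 'v) qf"

fun wf_qf :: "'f signature \<Rightarrow> ('f, 'v) qf \<Rightarrow> bool" where
  "wf_qf \<Sigma> TT \<longleftrightarrow> True"
| "wf_qf \<Sigma> FF \<longleftrightarrow> True"
| "wf_qf \<Sigma> (Atom q) \<longleftrightarrow> (\<forall>t \<in> set_uprod q. wf_trm \<Sigma> t)"
| "wf_qf \<Sigma> (Neg F) \<longleftrightarrow> wf_qf \<Sigma> F"
| "wf_qf \<Sigma> (And F G) \<longleftrightarrow> wf_qf \<Sigma> F \<and> wf_qf \<Sigma> G"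
| "wf_qf \<Sigma> (Or F G) \<longleftrightarrow> wf_qf \<Sigma> F \<and> wf_qf \<Sigma> G"
| "wf_qf \<Sigma> (Imp F G) \<longleftrightarrow> wf_qf \<Sigma> F \<and> wf_qf \<Sigma> G"

fun vars_qf :: "('f, 'v) qf \<Rightarrow> 'v set" where
  "vars_qf TT = {}"
| "vars_qf FF = {}"
| "vars_qf (Atom q) = vars_eqn q"
| "vars_qf (Neg F) = vars_qf F"
| "vars_qf (And F G) = vars_qf F \<union> vars_qf G"
| "vars_qf (Or F G) = vars_qf F \<union> vars_qf G"
| "vars_qf (Imp F G) = vars_qf F \<union> vars_qf G"

definition big_and :: "('f, 'v) qf list \<Rightarrow> ('f, 'v) qf" where
  "big_and Fs = foldr And Fs TT"

text \<open>A structure has a nonempty carrier \<open>D\<close> closed under the interpretation \<open>I\<close>.\<close>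

definition is_structure :: "'f signature \<Rightarrow> 'a set \<Rightarrow> ('f \<Rightarrow> 'a list \<Rightarrow> 'a) \<Rightarrow> bool" where
  "is_structure \<Sigma> D I \<longleftrightarrow> D \<noteq> {} \<and>
     (\<forall>f as. \<Sigma> f = Some (length as) \<and> set as \<subseteq> D \<longrightarrow> I f as \<in> D)"

fun trm_val :: "('f \<Rightarrow> 'a list \<Rightarrow> 'a) \<Rightarrow> ('v \<Rightarrow> 'a) \<Rightarrow> ('f, 'v) trm \<Rightarrow> 'a" where
  "trm_val I \<sigma> (Var x) = \<sigma> x"
| "trm_val I \<sigma> (Fun f ts) = I f (map (trm_val I \<sigma>) ts)"

definition sat_eqn :: "('f \<Rightarrow> 'a list \<Rightarrow> 'a) \<Rightarrow> ('v \<Rightarrow> 'a) \<Rightarrow> ('f, 'v) eqn \<Rightarrow> bool" where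
  "sat_eqn I \<sigma> q \<longleftrightarrow> (\<forall>t \<in> set_uprod q. \<forall>u \<in> set_uprod q. trm_val I \<sigma> t = trm_val I \<sigma> u)"

lemma sat_eqn_Upair [simp]: "sat_eqn I \<sigma> (Upair t u) \<longleftrightarrow> trm_val I \<sigma> t = trm_val I \<sigma> u"
  by (auto simp: sat_eqn_def)

fun sat :: "('f \<Rightarrow> 'a list \<Rightarrow> 'a) \<Rightarrow> ('v \<Rightarrow> 'a) \<Rightarrow> ('f, 'v) qf \<Rightarrow> bool" where
  "sat I \<sigma> TT \<longleftrightarrow> True"
| "sat I \<sigma> FF \<longleftrightarrow> False"
| "sat I \<sigma> (Atom q) \<longleftrightarrow> sat_eqn I \<sigma> q"
| "sat I \<sigma> (Neg F) \<longleftrightarrow> \<not> sat I \<sigma> F"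
| "sat I \<sigma> (And F G) \<longleftrightarrow> sat I \<sigma> F \<and> sat I \<sigma> G"
| "sat I \<sigma> (Or F G) \<longleftrightarrow> sat I \<sigma> F \<or> sat I \<sigma> G"
| "sat I \<sigma> (Imp F G) \<longleftrightarrow> (sat I \<sigma> F \<longrightarrow> sat I \<sigma> G)"

text \<open>
  Validity with respect to the empty theory: truth under all assignments in all structures. As one
  cannot quantify over types, the carriers range over the nonempty subsets of a type \<open>'a\<close>. For
  infinite \<open>'a\<close> this is validity in all structures whatsoever, as shown by
  \<open>valid_all_universes\<close> below.
\<close>

definition valid :: "'a itself \<Rightarrow> 'f signature \<Rightarrow> ('f, 'v) qf \<Rightarrow> bool" where
  "valid TYPE('a) \<Sigma> F \<longleftrightarrow>
     (\<forall>(D :: 'a set) I \<sigma>. is_structure \<Sigma> D I \<and> range \<sigma> \<subseteq> D \<longrightarrow> sat I \<sigma> F)"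

fun subtrms :: "('f, 'v) trm \<Rightarrow> ('f, 'v) trm set" where
  "subtrms (Var x) = {Var x}"
| "subtrms (Fun f ts) = insert (Fun f ts) (\<Union>t \<in> set ts. subtrms t)"

fun subtrms_qf :: "('f, 'v) qf \<Rightarrow> ('f, 'v) trm set" where
  "subtrms_qf TT = {}"
| "subtrms_qf FF = {}"
| "subtrms_qf (Atom q) = (\<Union>t \<in> set_uprod q. subtrms t)"
| "subtrms_qf (Neg F) = subtrms_qf F"
| "subtrms_qf (And F G) = subtrms_qf F \<union> subtrms_qf G"
| "subtrms_qf (Or F G) = subtrms_qf F \<union> subtrms_qf G"
| "subtrms_qf (Imp F G) = subtrms_qf F \<union> subtrms_qf G"

lemma finite_subtrms: "finite (subtrms t)"
  by (induction t) auto

lemma finite_subtrms_qf: "finite (subtrms_qf F)"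
  by (induction F) (auto simp: finite_subtrms)

lemma subtrms_self: "t \<in> subtrms t"
  by (cases t) auto

theorem valid_all_universes:
  fixes D :: "'b set" and F :: "('f, 'v) qf"
  assumes val: "valid TYPE('a::infinite) \<Sigma> F"
    and str: "is_structure \<Sigma> D I" and rng: "range \<sigma> \<subseteq> D"
  shows "sat I \<sigma> F"
proof -
  obtain d where d: "d \<in> D" using str by (auto simp: is_structure_def)
  define V where "V = insert d (trm_val I \<sigma> ` subtrms_qf F)"
  have finV: "finite V" by (simp add: V_def finite_subtrms_qf)
  obtain g :: "'b \<Rightarrow> 'a" where g: "inj_on g V"
    using arb_inj_on_finite_infinite[OF finV] by blast
  define c where "c b = (if b \<in> V then g b else g d)" for b
  define h where "h = inv_into V g"
  define J where "J f as = c (I f (map h as))" for f as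
  have c_in: "c b \<in> g ` V" for b by (auto simp: c_def V_def)
  have hc: "h (c b) = b" if "b \<in> V" for b using that g by (simp add: h_def c_def)
  have ev: "trm_val J (\<lambda>x. c (\<sigma> x)) t = c (trm_val I \<sigma> t)" if "trm_val I \<sigma> ` subtrms t \<subseteq> V" for t
    using that
  proof (induction t)
    case (Fun f ts)
    have "h (trm_val J (\<lambda>x. c (\<sigma> x)) t) = trm_val I \<sigma> t" if t: "t \<in> set ts" for t
    proof -
      have sub: "trm_val I \<sigma> ` subtrms t \<subseteq> V" using Fun.prems t by auto
      then have "trm_val I \<sigma> t \<in> V" using subtrms_self by blast
      then show ?thesis using Fun.IH[OF t sub] hc by metis
    qed
    then have "map h (map (trm_val J (\<lambda>x. c (\<sigma> x))) ts) = map (trm_val I \<sigma>) ts"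
      by simp
    then show ?case using J_def[of f "map (trm_val J (\<lambda>x. c (\<sigma> x))) ts"]
      by (simp only: trm_val.simps)
  qed simp
  have sat_eq: "sat J (\<lambda>x. c (\<sigma> x)) G \<longleftrightarrow> sat I \<sigma> G" if "trm_val I \<sigma> ` subtrms_qf G \<subseteq> V" for G
    using that
  proof (induction G)
    case (Atom q)
    obtain t u where q: "q = Upair t u" by (cases q)
    have t: "trm_val I \<sigma> ` subtrms t \<subseteq> V" and u: "trm_val I \<sigma> ` subtrms u \<subseteq> V"
      using Atom by (auto simp: q)
    then have "trm_val I \<sigma> t \<in> V" "trm_val I \<sigma> u \<in> V" using subtrms_self by blast+
    then have "c (trm_val I \<sigma> t) = c (trm_val I \<sigma> u) \<longleftrightarrow> trm_val I \<sigma> t = trm_val I \<sigma> u"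
      by (metis hc)
    then show ?case by (simp add: q ev[OF t] ev[OF u])
  qed (auto simp: image_Un)
  have "is_structure \<Sigma> (g ` V) J"
    unfolding is_structure_def J_def using c_in V_def by auto
  moreover have "range (\<lambda>x. c (\<sigma> x)) \<subseteq> g ` V" using c_in by auto
  ultimately have "sat J (\<lambda>x. c (\<sigma> x)) F" using val by (auto simp: valid_def)
  then show ?thesis using sat_eq[of F] by (auto simp: V_def)
qed

section \<open>Covers\<close>

text \<open>
  \<open>\<psi>(y)\<close> is a cover of \<open>\<exists>e. \<phi>(e,y)\<close>. The formulas \<open>\<theta>(y,z)\<close>, for arbitrary further
  variables \<open>z\<close>, are the quantifier-free formulas in which no \<open>e\<close> occurs.
\<close>

definition is_cover ::
  "'a::infinite itself \<Rightarrow> 'f signature \<Rightarrow> 'v set \<Rightarrow> 'v set \<Rightarrow> ('f, 'v) qf \<Rightarrow> ('f, 'v) qf \<Rightarrow> bool"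
where
  "is_cover TYPE('a) \<Sigma> e y \<phi> \<psi> \<longleftrightarrow>
     wf_qf \<Sigma> \<psi> \<and> vars_qf \<psi> \<subseteq> y \<and>
     valid TYPE('a) \<Sigma> (Imp \<phi> \<psi>) \<and>
     (\<forall>\<theta>. wf_qf \<Sigma> \<theta> \<and> vars_qf \<theta> \<inter> e = {} \<and> valid TYPE('a) \<Sigma> (Imp \<phi> \<theta>) \<longrightarrow>
        valid TYPE('a) \<Sigma> (Imp \<psi> \<theta>))"

section \<open>Flat terms and literals\<close>

definition e_free :: "'v set \<Rightarrow> ('f, 'v) trm \<Rightarrow> bool" where
  "e_free e t \<longleftrightarrow> vars t \<inter> e = {}"

definition e_atom :: "'v set \<Rightarrow> ('f, 'v) trm \<Rightarrow> bool" where
  "e_atom e t \<longleftrightarrow> e_free e t \<or> t \<in> Var ` e"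

definition e_flat :: "'v set \<Rightarrow> ('f, 'v) trm \<Rightarrow> bool" where
  "e_flat e t \<longleftrightarrow> e_free e t \<or> t \<in> Var ` e \<or>
     (\<exists>f us. t = Fun f us \<and> (\<forall>u \<in> set us. e_atom e u))"

datatype ('f, 'v) lit = Eq "('f, 'v) eqn" | Neq "('f, 'v) eqn" | Bot

fun eqns_lit :: "('f, 'v) lit \<Rightarrow> ('f, 'v) eqn set" where
  "eqns_lit (Eq q) = {q}"
| "eqns_lit (Neq q) = {q}"
| "eqns_lit Bot = {}"

definition trms_lit :: "('f, 'v) lit \<Rightarrow> ('f, 'v) trm set" where
  "trms_lit L = (\<Union>q \<in> eqns_lit L. set_uprod q)"

fun qf_of_lit :: "('f, 'v) lit \<Rightarrow> ('f, 'v) qf" where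
  "qf_of_lit (Eq q) = Atom q"
| "qf_of_lit (Neq q) = Neg (Atom q)"
| "qf_of_lit Bot = FF"

definition e_free_lit :: "'v set \<Rightarrow> ('f, 'v) lit \<Rightarrow> bool" where
  "e_free_lit e L \<longleftrightarrow> (\<forall>t \<in> trms_lit L. e_free e t)"

definition e_flat_lit :: "'v set \<Rightarrow> ('f, 'v) lit \<Rightarrow> bool" where
  "e_flat_lit e L \<longleftrightarrow>
     (\<exists>t a. L = Eq (Upair t a) \<and> e_flat e t \<and> e_atom e a) \<or>
     (\<exists>a b. L = Neq (Upair a b) \<and> e_atom e a \<and> e_atom e b)"

definition ground_trms :: "'f signature \<Rightarrow> 'v set \<Rightarrow> 'v set \<Rightarrow> ('f, 'v) trm set" where
  "ground_trms \<Sigma> e y = {t. wf_trm \<Sigma> t \<and> vars t \<subseteq> e \<union> y}"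

text \<open>The matrix \<open>\<phi>(e,y)\<close> of a primitive flat formula, as the list of its conjuncts.\<close>

definition primitive_e_flat ::
  "'f signature \<Rightarrow> 'v set \<Rightarrow> 'v set \<Rightarrow> ('f, 'v) lit list \<Rightarrow> bool" where
  "primitive_e_flat \<Sigma> e y \<phi> \<longleftrightarrow>
     (\<forall>L \<in> set \<phi>. e_flat_lit e L \<and> trms_lit L \<subseteq> ground_trms \<Sigma> e y)"

section \<open>Term orderings\<close>

text \<open>
  On ground terms, stability under substitutions is void, so a total reduction ordering is a
  well-founded total strict order closed under contexts.
\<close>

definition ground_reduction_ordering ::
  "('f, 'v) trm set \<Rightarrow> (('f, 'v) trm \<Rightarrow> ('f, 'v) trm \<Rightarrow> bool) \<Rightarrow> bool" where
  "ground_reduction_ordering G gt \<longleftrightarrow>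
     irreflp_on G gt \<and> transp_on G gt \<and> totalp_on G gt \<and> wfp_on G (\<lambda>s t. gt t s) \<and>
     (\<forall>f ts s t us. Fun f (ts @ s # us) \<in> G \<and> Fun f (ts @ t # us) \<in> G \<and> gt s t \<longrightarrow>
        gt (Fun f (ts @ s # us)) (Fun f (ts @ t # us)))"

definition orients_flat_eqns ::
  "('f, 'v) trm set \<Rightarrow> 'v set \<Rightarrow> (('f, 'v) trm \<Rightarrow> ('f, 'v) trm \<Rightarrow> bool) \<Rightarrow> bool" where
  "orients_flat_eqns G e gt \<longleftrightarrow>
     (\<forall>t \<in> G. \<forall>a \<in> G. e_flat e t \<and> \<not> e_free e t \<and>
        (e_free e a \<or> t \<notin> Var ` e \<and> a \<in> Var ` e) \<longrightarrow> gt t a)"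

section \<open>The constrained superposition calculus\<close>

text \<open>
  \<open>E e t u C\<close> holds iff the procedure \<open>E(t,u)\<close> does not fail and returns \<open>C\<close>; failure is the
  absence of a derivation.
\<close>

inductive E :: "'v set \<Rightarrow> ('f, 'v) trm \<Rightarrow> ('f, 'v) trm \<Rightarrow> ('f, 'v) eqn set \<Rightarrow> bool" for e where
  same: "E e t t {}"
| free: "t \<noteq> u \<Longrightarrow> e_free e t \<Longrightarrow> e_free e u \<Longrightarrow> E e t u {Upair t u}"
| args: "\<not> e_free e (Fun f ts) \<Longrightarrow> \<not> e_free e (Fun f us) \<Longrightarrow>
    length us = length ts \<Longrightarrow> length Cs = length ts \<Longrightarrow>
    (\<And>i. i < length ts \<Longrightarrow> E e (ts ! i) (us ! i) (Cs ! i)) \<Longrightarrow>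
    E e (Fun f ts) (Fun f us) (\<Union> (set Cs))"

fun is_pos :: "('f, 'v) trm \<Rightarrow> nat list \<Rightarrow> bool" where
  "is_pos t [] \<longleftrightarrow> True"
| "is_pos (Var x) (i # p) \<longleftrightarrow> False"
| "is_pos (Fun f ts) (i # p) \<longleftrightarrow> i < length ts \<and> is_pos (ts ! i) p"

fun subt_at :: "('f, 'v) trm \<Rightarrow> nat list \<Rightarrow> ('f, 'v) trm" where
  "subt_at t [] = t"
| "subt_at (Fun f ts) (i # p) = subt_at (ts ! i) p"

fun replace_at :: "('f, 'v) trm \<Rightarrow> nat list \<Rightarrow> ('f, 'v) trm \<Rightarrow> ('f, 'v) trm" where
  "replace_at t [] r = r"
| "replace_at (Fun f ts) (i # p) r = Fun f (ts[i := replace_at (ts ! i) p r])"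

text \<open>
  \<open>rewrite_lit l r L L'\<close>: there is a position \<open>p\<close> of the literal \<open>L\<close> such that \<open>l\<close> is the
  subterm of \<open>L\<close> at \<open>p\<close> and \<open>L'\<close> is \<open>L[r]\<^sub>p\<close>.
\<close>

inductive rewrite_lit ::
  "('f, 'v) trm \<Rightarrow> ('f, 'v) trm \<Rightarrow> ('f, 'v) lit \<Rightarrow> ('f, 'v) lit \<Rightarrow> bool" for l r where
  "is_pos t p \<Longrightarrow> subt_at t p = l \<Longrightarrow>
     rewrite_lit l r (Eq (Upair t u)) (Eq (Upair (replace_at t p r) u))"
| "is_pos t p \<Longrightarrow> subt_at t p = l \<Longrightarrow>
     rewrite_lit l r (Neq (Upair t u)) (Neq (Upair (replace_at t p r) u))"

datatype ('f, 'v) clit =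
  Constrained (lit: "('f, 'v) lit") (cnstr: "('f, 'v) eqn set")  (infix "\<parallel>" 55)

abbreviation e_free_clit :: "'v set \<Rightarrow> ('f, 'v) clit \<Rightarrow> bool" where
  "e_free_clit e K \<equiv> e_free_lit e (lit K)"

inductive inference ::
  "'v set \<Rightarrow> (('f, 'v) trm \<Rightarrow> ('f, 'v) trm \<Rightarrow> bool) \<Rightarrow> ('f, 'v) clit set \<Rightarrow> ('f, 'v) clit \<Rightarrow> bool"
  for e gt S where
  superposition_right:
    "Eq (Upair l r) \<parallel> C \<in> S \<Longrightarrow> \<not> e_free_lit e (Eq (Upair l r)) \<Longrightarrow>
     Eq (Upair s t) \<parallel> D \<in> S \<Longrightarrow> \<not> e_free_lit e (Eq (Upair s t)) \<Longrightarrow>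
     gt l r \<Longrightarrow> gt s t \<Longrightarrow> is_pos s p \<Longrightarrow> E e (subt_at s p) l B \<Longrightarrow>
     inference e gt S (Eq (Upair (replace_at s p r) t) \<parallel> (C \<union> D \<union> B))"
| superposition_left:
    "Eq (Upair l r) \<parallel> C \<in> S \<Longrightarrow> \<not> e_free_lit e (Eq (Upair l r)) \<Longrightarrow>
     Neq (Upair s t) \<parallel> D \<in> S \<Longrightarrow> \<not> e_free_lit e (Neq (Upair s t)) \<Longrightarrow>
     gt l r \<Longrightarrow> gt s t \<Longrightarrow> is_pos s p \<Longrightarrow> E e (subt_at s p) l B \<Longrightarrow>
     inference e gt S (Neq (Upair (replace_at s p r) t) \<parallel> (C \<union> D \<union> B))"
| reflexion:
    "Neq (Upair t u) \<parallel> C \<in> S \<Longrightarrow> \<not> e_free_lit e (Neq (Upair t u)) \<Longrightarrow> E e t u B \<Longrightarrow>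
     inference e gt S (Bot \<parallel> (C \<union> B))"

definition solved :: "'v set \<Rightarrow> ('f, 'v) clit \<Rightarrow> bool" where
  "solved e K \<longleftrightarrow> (\<exists>x t D. K = Eq (Upair (Var x) t) \<parallel> D \<and> x \<in> e \<and> e_free e t)"

text \<open>
  \<open>demod e gt K N K'\<close>: Demodulation with first premise \<open>K\<close> and second premise \<open>N\<close> is admissible
  and yields \<open>K'\<close>. The last condition says that, among two constrained literals \<open>x = s \<parallel> D\<close> and
  \<open>x = t \<parallel> D\<close>, the one with the smaller right-hand side is kept; it also prevents a constrained
  literal from demodulating (and thereby deleting) itself.
\<close>

inductive demod ::
  "'v set \<Rightarrow> (('f, 'v) trm \<Rightarrow> ('f, 'v) trm \<Rightarrow> bool) \<Rightarrow>
    ('f, 'v) clit \<Rightarrow> ('f, 'v) clit \<Rightarrow> ('f, 'v) clit \<Rightarrow> bool" for e gt where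
  "x \<in> e \<Longrightarrow> e_free e t \<Longrightarrow> gt (Var x) t \<Longrightarrow> rewrite_lit (Var x) t L L' \<Longrightarrow> D \<subseteq> C \<Longrightarrow>
   (\<And>s. e_free e s \<Longrightarrow> L = Eq (Upair (Var x) s) \<Longrightarrow> C = D \<Longrightarrow> gt s t) \<Longrightarrow>
   demod e gt (L \<parallel> C) (Eq (Upair (Var x) t) \<parallel> D) (L' \<parallel> C)"

definition demod_by ::
  "'v set \<Rightarrow> (('f, 'v) trm \<Rightarrow> ('f, 'v) trm \<Rightarrow> bool) \<Rightarrow>
    ('f, 'v) clit set \<Rightarrow> ('f, 'v) clit \<Rightarrow> ('f, 'v) clit \<Rightarrow> bool" where
  "demod_by e gt S K K' \<longleftrightarrow> (\<exists>N \<in> S. demod e gt K N K')"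

inductive step ::
  "'v set \<Rightarrow> (('f, 'v) trm \<Rightarrow> ('f, 'v) trm \<Rightarrow> bool) \<Rightarrow>
    ('f, 'v) clit set \<Rightarrow> ('f, 'v) clit set \<Rightarrow> bool" for e gt where
  demodulate:
    "K \<in> S \<Longrightarrow> demod_by e gt S K K' \<Longrightarrow>
     solved e K \<or> \<not> (\<exists>K1 \<in> S. solved e K1 \<and> Ex (demod_by e gt S K1)) \<Longrightarrow>
     step e gt S (insert K' (S - {K}))"
| infer:
    "\<not> (\<exists>K1 \<in> S. Ex (demod_by e gt S K1)) \<Longrightarrow> inference e gt S K \<Longrightarrow>
     step e gt S (insert K S)"

definition saturated ::
  "'v set \<Rightarrow> (('f, 'v) trm \<Rightarrow> ('f, 'v) trm \<Rightarrow> bool) \<Rightarrow> ('f, 'v) clit set \<Rightarrow> bool" where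
  "saturated e gt S \<longleftrightarrow>
     (\<forall>K. inference e gt S K \<longrightarrow>
        (\<exists>K' \<in> S. (demod_by e gt S)\<^sup>*\<^sup>* K K' \<and> \<not> Ex (demod_by e gt S K')))"

text \<open>
  The formulas \<open>\<And>C \<rightarrow> L\<close> and the output formula are determined up to the enumeration of the
  finite sets involved.
\<close>

definition is_clause_qf :: "('f, 'v) clit \<Rightarrow> ('f, 'v) qf \<Rightarrow> bool" where
  "is_clause_qf K F \<longleftrightarrow>
     (\<exists>qs. set qs = cnstr K \<and> F = Imp (big_and (map Atom qs)) (qf_of_lit (lit K)))"

definition algorithm_output ::
  "'v set \<Rightarrow> (('f, 'v) trm \<Rightarrow> ('f, 'v) trm \<Rightarrow> bool) \<Rightarrow> ('f, 'v) lit list \<Rightarrow> ('f, 'v) qf \<Rightarrow> bool"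
where
  "algorithm_output e gt \<phi> \<psi> \<longleftrightarrow>
     (\<exists>S Ks Fs. (step e gt)\<^sup>*\<^sup>* {L \<parallel> {} | L. L \<in> set \<phi>} S \<and> saturated e gt S \<and>
        set Ks = {K \<in> S. e_free_clit e K} \<and>
        list_all2 is_clause_qf Ks Fs \<and> \<psi> = big_and Fs)"

end

theory Submission
  imports Defs
begin

text \<open>
  Call a literal active in a model of the output if it occurs in the saturated set with a
  constraint that is true in the model. The model is extended directly, without a completeness
  theorem for superposition. An active equation orienting some \<open>x \<in> e\<close> to an atom gives \<open>x\<close> the
  value of that atom, and the remaining variables of \<open>e\<close> become new elements. An active equation
  \<open>f(u\<^sub>1,\<dots>,u\<^sub>k) = b\<close> with irreducible atoms \<open>u\<^sub>i\<close> defines \<open>f\<close> at the values of the \<open>u\<^sub>i\<close>. Saturation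
  makes these choices coherent, and all active literals true, by induction on their larger side: the
  procedure \<open>E\<close> succeeds with a true constraint on any two left-hand sides with the same values.
  Demodulation only replaces a literal by an equivalent one, so the input is true in the extension,
  and a formula without variables of \<open>e\<close> has the same truth value in both models.
\<close>

section \<open>Positions, replacement and soundness of the calculus\<close>

lemma e_free_subt_at: "e_free e s \<Longrightarrow> is_pos s p \<Longrightarrow> e_free e (subt_at s p)"
proof (induction s p rule: is_pos.induct)
  case (3 f ts i p)
  have "e_free e (ts ! i)" using 3 by (auto simp: e_free_def dest: nth_mem)
  then show ?case using 3 by simp
qed auto

lemma ground_trms_nth: "Fun f ts \<in> ground_trms \<Sigma> e y \<Longrightarrow> u \<in> set ts \<Longrightarrow> u \<in> ground_trms \<Sigma> e y"
  by (auto simp: ground_trms_def)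

lemma ground_trms_list_update:
  assumes "Fun f ts \<in> ground_trms \<Sigma> e y" "u \<in> ground_trms \<Sigma> e y"
  shows "Fun f (ts[i := u]) \<in> ground_trms \<Sigma> e y"
proof -
  have "set (ts[i := u]) \<subseteq> insert u (set ts)" by (rule set_update_subset_insert)
  then show ?thesis using assms unfolding ground_trms_def by fastforce
qed

lemma ground_trms_subt_at:
  "s \<in> ground_trms \<Sigma> e y \<Longrightarrow> is_pos s p \<Longrightarrow> subt_at s p \<in> ground_trms \<Sigma> e y"
proof (induction s p rule: is_pos.induct)
  case (3 f ts i p)
  then show ?case using ground_trms_nth[OF 3(2), of "ts ! i"] by simp
qed auto

lemma ground_trms_replace_at:
  assumes "r \<in> ground_trms \<Sigma> e y"
  shows "s \<in> ground_trms \<Sigma> e y \<Longrightarrow> is_pos s p \<Longrightarrow> replace_at s p r \<in> ground_trms \<Sigma> e y"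
proof (induction s p rule: is_pos.induct)
  case (3 f ts i p)
  then show ?case using ground_trms_nth[OF 3(2), of "ts ! i"]
    by (auto intro: ground_trms_list_update)
qed (use assms in auto)

lemma trm_val_replace_at:
  "is_pos s p \<Longrightarrow> trm_val I \<sigma> (subt_at s p) = trm_val I \<sigma> r \<Longrightarrow>
   trm_val I \<sigma> (replace_at s p r) = trm_val I \<sigma> s"
proof (induction s p rule: is_pos.induct)
  case (3 f ts i p)
  then have "trm_val I \<sigma> (replace_at (ts ! i) p r) = trm_val I \<sigma> (ts ! i)" by simp
  then have "map (trm_val I \<sigma>) (ts[i := replace_at (ts ! i) p r]) = map (trm_val I \<sigma>) ts"
    using 3(2) by (simp add: map_update list_update_same_conv)
  then show ?case by (simp only: replace_at.simps trm_val.simps)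
qed auto

text \<open>Constraints are emitted exactly where two distinct e-free subterms meet; once these are
  identified, congruence closes the remaining positions.\<close>

lemma E_sound: "E e t u C \<Longrightarrow> \<forall>q \<in> C. sat_eqn I \<sigma> q \<Longrightarrow> trm_val I \<sigma> t = trm_val I \<sigma> u"
proof (induction rule: E.induct)
  case (args f ts us Cs)
  have "map (trm_val I \<sigma>) ts = map (trm_val I \<sigma>) us"
  proof (rule nth_equalityI)
    fix i assume i: "i < length (map (trm_val I \<sigma>) ts)"
    then have "\<forall>q \<in> Cs ! i. sat_eqn I \<sigma> q" using args by auto
    then show "map (trm_val I \<sigma>) ts ! i = map (trm_val I \<sigma>) us ! i" using args i by simp
  qed (use args in simp)
  then show ?case by (simp only: trm_val.simps)
qed auto

text \<open>Carries non-e-freeness from a left-hand side to the subterm it overlaps, so no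
  superposition rewrites an e-free subterm.\<close>

lemma E_e_free_iff: "E e t u C \<Longrightarrow> e_free e t \<longleftrightarrow> e_free e u"
  by (induction rule: E.induct) auto

text \<open>Needed so that constraints keep their truth value when the model is extended by values
  for \<open>e\<close>.\<close>

lemma E_constraints:
  "E e t u C \<Longrightarrow> t \<in> ground_trms \<Sigma> e y \<Longrightarrow> u \<in> ground_trms \<Sigma> e y \<Longrightarrow>
   \<forall>q \<in> C. \<forall>a \<in> set_uprod q. e_free e a \<and> a \<in> ground_trms \<Sigma> e y"
proof (induction rule: E.induct)
  case (args f ts us Cs)
  show ?case
  proof
    fix q assume "q \<in> \<Union> (set Cs)"
    then obtain i where i: "i < length ts" "q \<in> Cs ! i"
      using args(4) by (auto simp: in_set_conv_nth)
    have "ts ! i \<in> ground_trms \<Sigma> e y" "us ! i \<in> ground_trms \<Sigma> e y"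
      using args(3,7,8) i by (auto intro: ground_trms_nth)
    then show "\<forall>a \<in> set_uprod q. e_free e a \<and> a \<in> ground_trms \<Sigma> e y" using args(6) i by blast
  qed
qed auto

section \<open>Soundness of the rules in an arbitrary interpretation\<close>

definition holds :: "('f \<Rightarrow> 'a list \<Rightarrow> 'a) \<Rightarrow> ('v \<Rightarrow> 'a) \<Rightarrow> ('f, 'v) clit \<Rightarrow> bool" where
  "holds I \<sigma> K \<longleftrightarrow> (\<forall>q \<in> cnstr K. sat_eqn I \<sigma> q) \<longrightarrow> sat I \<sigma> (qf_of_lit (lit K))"

lemma sat_rewrite_lit:
  assumes "rewrite_lit l r L L'" "trm_val I \<sigma> l = trm_val I \<sigma> r"
  shows "sat I \<sigma> (qf_of_lit L') \<longleftrightarrow> sat I \<sigma> (qf_of_lit L)"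
  using assms by (auto elim!: rewrite_lit.cases simp: trm_val_replace_at)

lemma inference_sound:
  assumes "inference e gt S K" "\<forall>K \<in> S. holds I \<sigma> K"
  shows "holds I \<sigma> K"
  using assms(1)
proof cases
  case (superposition_right l r C s t D p B)
  have "holds I \<sigma> (Eq (Upair l r) \<parallel> C)" "holds I \<sigma> (Eq (Upair s t) \<parallel> D)"
    using superposition_right assms(2) by auto
  then show ?thesis
    using superposition_right trm_val_replace_at[of s p I \<sigma> r] E_sound[of e "subt_at s p" l B I \<sigma>]
    by (simp add: holds_def)
next
  case (superposition_left l r C s t D p B)
  have "holds I \<sigma> (Eq (Upair l r) \<parallel> C)" "holds I \<sigma> (Neq (Upair s t) \<parallel> D)"
    using superposition_left assms(2) by auto
  then show ?thesis
    using superposition_left trm_val_replace_at[of s p I \<sigma> r] E_sound[of e "subt_at s p" l B I \<sigma>]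
    by (simp add: holds_def)
next
  case (reflexion t u C B)
  have "holds I \<sigma> (Neq (Upair t u) \<parallel> C)" using reflexion assms(2) by auto
  then show ?thesis using reflexion E_sound[of e t u B I \<sigma>] by (auto simp: holds_def)
qed

text \<open>If the constraint of \<open>K\<close> is true, so is the smaller one of
  \<open>N\<close>, and the rewriting preserves values; otherwise both sides are vacuous. An
  equivalence is stated because Demodulation deletes \<open>K\<close>.\<close>

lemma demod_holds_iff:
  assumes "demod e gt K N K'" "holds I \<sigma> N"
  shows "holds I \<sigma> K' \<longleftrightarrow> holds I \<sigma> K"
  using assms
proof cases
  case (1 x t L L' D C)
  show ?thesis
  proof (cases "\<forall>q \<in> C. sat_eqn I \<sigma> q")
    case True
    then have "trm_val I \<sigma> (Var x) = trm_val I \<sigma> t" using 1 assms(2) by (auto simp: holds_def)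
    then have "sat I \<sigma> (qf_of_lit L') \<longleftrightarrow> sat I \<sigma> (qf_of_lit L)" by (rule sat_rewrite_lit[OF 1(7)])
    then show ?thesis using 1 by (simp add: holds_def)
  qed (use 1 in \<open>auto simp: holds_def\<close>)
qed

lemma step_sound:
  assumes "step e gt S S'" "\<forall>K \<in> S. holds I \<sigma> K"
  shows "\<forall>K \<in> S'. holds I \<sigma> K"
  using assms
proof cases
  case (demodulate K K')
  then show ?thesis using assms(2) demod_holds_iff unfolding demod_by_def by blast
next
  case (infer K)
  then show ?thesis using assms(2) inference_sound by blast
qed

lemma sat_big_and: "sat I \<sigma> (big_and Fs) \<longleftrightarrow> (\<forall>F \<in> set Fs. sat I \<sigma> F)"
  by (induction Fs) (auto simp: big_and_def)

lemma wf_qf_big_and: "wf_qf \<Sigma> (big_and Fs) \<longleftrightarrow> (\<forall>F \<in> set Fs. wf_qf \<Sigma> F)"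
  by (induction Fs) (auto simp: big_and_def)

lemma vars_qf_big_and: "vars_qf (big_and Fs) = (\<Union>F \<in> set Fs. vars_qf F)"
  by (induction Fs) (auto simp: big_and_def)

lemma sat_is_clause_qf: "is_clause_qf K F \<Longrightarrow> sat I \<sigma> F \<longleftrightarrow> holds I \<sigma> K"
  by (auto simp: is_clause_qf_def holds_def sat_big_and)

section \<open>Flatness is preserved\<close>

lemma e_flat_if_e_atom: "e_atom e t \<Longrightarrow> e_flat e t"
  by (auto simp: e_atom_def e_flat_def)

lemma not_e_free_Var: "x \<in> e \<Longrightarrow> \<not> e_free e (Var x)"
  by (simp add: e_free_def)

lemma e_flat_Eq_iff:
  "e_flat_lit e (Eq (Upair s t)) \<longleftrightarrow> e_flat e s \<and> e_atom e t \<or> e_atom e s \<and> e_flat e t"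
  by (auto simp: e_flat_lit_def)

lemma e_flat_Neq_iff: "e_flat_lit e (Neq (Upair s t)) \<longleftrightarrow> e_atom e s \<and> e_atom e t"
  by (auto simp: e_flat_lit_def)

text \<open>Below the root of a flat term that is not e-free stand only atoms, so a subterm
  containing a variable of \<open>e\<close> is the whole term or a direct argument.\<close>

lemma e_flat_pos_cases:
  assumes "e_flat e s" "is_pos s p" "\<not> e_free e (subt_at s p)"
  obtains "p = []"
  | f us i x where "s = Fun f us" "i < length us" "p = [i]" "x \<in> e" "us ! i = Var x"
      "\<forall>u \<in> set us. e_atom e u"
proof (cases p)
  case (Cons i q)
  have nf: "\<not> e_free e s" using e_free_subt_at[OF _ assms(2)] assms(3) by blast
  moreover have "s \<notin> Var ` e" using Cons assms(2) by auto
  ultimately obtain f us where s: "s = Fun f us" "\<forall>u \<in> set us. e_atom e u"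
    using assms(1) by (auto simp: e_flat_def)
  have i: "i < length us" "is_pos (us ! i) q" using Cons assms(2) s by auto
  then have "\<not> e_free e (us ! i)" using Cons assms(3) s e_free_subt_at by fastforce
  then obtain x where x: "x \<in> e" "us ! i = Var x" using s i by (auto simp: e_atom_def)
  then have "q = []" using i by (cases q) auto
  then show ?thesis using that Cons s i x by blast
qed (use that in blast)

text \<open>An atom that is not e-free is a variable, so \<open>p\<close> can only be the
  root.\<close>

lemma e_atom_replace_at:
  assumes "e_atom e s" "is_pos s p" "\<not> e_free e (subt_at s p)" "e_atom e r"
  shows "e_atom e (replace_at s p r)"
  using e_flat_if_e_atom[OF assms(1)] assms(2,3)
proof (cases rule: e_flat_pos_cases)
  case (2 f us i x)
  have "\<not> e_free e s" using e_free_subt_at[OF _ assms(2)] assms(3) by blast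
  then show ?thesis using assms(1) 2 by (auto simp: e_atom_def)
qed (use assms in simp)

lemma e_flat_replace_at:
  assumes "e_flat e s" "is_pos s p" "\<not> e_free e (subt_at s p)" "e_atom e r"
  shows "e_flat e (replace_at s p r)"
  using assms(1-3)
proof (cases rule: e_flat_pos_cases)
  case (2 f us i x)
  then have "\<forall>u \<in> set (us[i := r]). e_atom e u"
    using assms(4) set_update_subset_insert[of us i r] by auto
  then show ?thesis using 2 by (auto simp: e_flat_def)
qed (use assms e_flat_if_e_atom in auto)

section \<open>The ordering on ground terms and the flatness invariant\<close>

locale flat_calculus =
  fixes \<Sigma> :: "'f signature" and e y :: "'v set"
    and gt :: "('f, 'v) trm \<Rightarrow> ('f, 'v) trm \<Rightarrow> bool"
  assumes ordering: "ground_reduction_ordering (ground_trms \<Sigma> e y) gt"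
    and orients: "orients_flat_eqns (ground_trms \<Sigma> e y) e gt"
begin

abbreviation G :: "('f, 'v) trm set" where "G \<equiv> ground_trms \<Sigma> e y"

lemma gt_irrefl: "t \<in> G \<Longrightarrow> \<not> gt t t"
  using ordering by (auto simp: ground_reduction_ordering_def irreflp_on_def)

lemma gt_trans: "s \<in> G \<Longrightarrow> t \<in> G \<Longrightarrow> u \<in> G \<Longrightarrow> gt s t \<Longrightarrow> gt t u \<Longrightarrow> gt s u"
  using ordering unfolding ground_reduction_ordering_def transp_on_def by blast

lemma gt_total: "s \<in> G \<Longrightarrow> t \<in> G \<Longrightarrow> s = t \<or> gt s t \<or> gt t s"
  using ordering unfolding ground_reduction_ordering_def totalp_on_def by blast

lemma gt_asym: "s \<in> G \<Longrightarrow> t \<in> G \<Longrightarrow> gt s t \<Longrightarrow> \<not> gt t s"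
  using gt_trans gt_irrefl by blast

lemma gt_induct [consumes 1, case_names less]:
  assumes "t \<in> G" "\<And>t. t \<in> G \<Longrightarrow> (\<And>u. u \<in> G \<Longrightarrow> gt t u \<Longrightarrow> P u) \<Longrightarrow> P t"
  shows "P t"
proof -
  have "wfp_on G (\<lambda>s t. gt t s)" using ordering by (simp add: ground_reduction_ordering_def)
  then show ?thesis using assms(1)
  proof (induction rule: wfp_on_induct)
    case (less t)
    then show ?case using assms(2) by blast
  qed (rule assms(1))
qed

lemma Var_in_G: "x \<in> e \<Longrightarrow> Var x \<in> G"
  by (simp add: ground_trms_def)

lemma gt_list_update:
  assumes "Fun f ts \<in> G" "u \<in> G" "i < length ts" "gt (ts ! i) u"
  shows "gt (Fun f ts) (Fun f (ts[i := u]))"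
proof -
  have eq: "ts = take i ts @ ts ! i # drop (Suc i) ts" "ts[i := u] = take i ts @ u # drop (Suc i) ts"
    using id_take_nth_drop[OF assms(3)] upd_conv_take_nth_drop[OF assms(3)] by simp_all
  have mono: "gt (Fun f (as @ s # bs)) (Fun f (as @ t # bs))"
    if "Fun f (as @ s # bs) \<in> G" "Fun f (as @ t # bs) \<in> G" "gt s t" for as bs s t
    using ordering that unfolding ground_reduction_ordering_def by blast
  show ?thesis
    using mono[of "take i ts" "ts ! i" "drop (Suc i) ts" u] assms
      ground_trms_list_update[OF assms(1,2), of i] unfolding eq(1)[symmetric] eq(2)[symmetric] by simp
qed

lemma gt_replace_at:
  assumes "r \<in> G"
  shows "s \<in> G \<Longrightarrow> is_pos s p \<Longrightarrow> gt (subt_at s p) r \<Longrightarrow> gt s (replace_at s p r)"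
proof (induction s p rule: is_pos.induct)
  case (3 f ts i p)
  have "ts ! i \<in> G" using 3(2,3) ground_trms_nth by fastforce
  then show ?case using 3 assms by (auto intro: gt_list_update ground_trms_replace_at)
qed auto

text \<open>If \<open>s\<close> were e-free, or if \<open>t\<close> were not an atom (which makes
  \<open>s\<close> a variable of \<open>e\<close>), the orientation condition would give
  \<open>gt t s\<close>, against asymmetry.\<close>

lemma oriented_flat_eqn:
  assumes "gt s t" "s \<in> G" "t \<in> G" "e_flat_lit e (Eq (Upair s t))"
    and "\<not> e_free_lit e (Eq (Upair s t))"
  shows "\<not> e_free e s" "e_flat e s" "e_atom e t"
proof -
  have fl: "e_flat e s" "e_flat e t"
    using assms(4) e_flat_if_e_atom unfolding e_flat_Eq_iff by blast+
  have nf: "\<not> e_free e s \<or> \<not> e_free e t" using assms(5) by (auto simp: e_free_lit_def trms_lit_def)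
  have ng: "\<not> gt t s" using assms gt_asym by blast
  show 1: "\<not> e_free e s" using nf ng fl orients assms(2,3) unfolding orients_flat_eqns_def by blast
  show "e_flat e s" by fact
  show "e_atom e t"
  proof (rule ccontr)
    assume a: "\<not> e_atom e t"
    then have "e_atom e s" using assms(4) unfolding e_flat_Eq_iff by blast
    then show False using a 1 ng fl orients assms(2,3)
      unfolding orients_flat_eqns_def e_atom_def by blast
  qed
qed

text \<open>The invariant of the whole run. \<open>Bot\<close> is listed separately because
  \<open>e_flat_lit\<close> covers only equations and disequations.\<close>

definition good :: "('f, 'v) clit \<Rightarrow> bool" where
  "good K \<longleftrightarrow> (lit K = Bot \<or> e_flat_lit e (lit K)) \<and> trms_lit (lit K) \<subseteq> G \<and>
     (\<forall>q \<in> cnstr K. \<forall>t \<in> set_uprod q. e_free e t \<and> t \<in> G)"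

lemma good_Eq_iff: "good (Eq (Upair s t) \<parallel> C) \<longleftrightarrow> e_flat_lit e (Eq (Upair s t)) \<and> s \<in> G \<and> t \<in> G \<and>
     (\<forall>q \<in> C. \<forall>t \<in> set_uprod q. e_free e t \<and> t \<in> G)"
  by (simp add: good_def trms_lit_def)

lemma good_Neq_iff: "good (Neq (Upair s t) \<parallel> C) \<longleftrightarrow> e_atom e s \<and> e_atom e t \<and> s \<in> G \<and> t \<in> G \<and>
     (\<forall>q \<in> C. \<forall>t \<in> set_uprod q. e_free e t \<and> t \<in> G)"
  by (simp add: good_def trms_lit_def e_flat_Neq_iff)

text \<open>The overlapped subterm is not e-free, hence a root or a direct argument of a flat term,
  and the atom \<open>r\<close> fits in either place.\<close>

lemma inference_good:
  assumes "inference e gt S K" "\<forall>K \<in> S. good K"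
  shows "good K"
  using assms(1)
proof cases
  case (superposition_right l r C s t D p B)
  have l: "good (Eq (Upair l r) \<parallel> C)" and s: "good (Eq (Upair s t) \<parallel> D)"
    using superposition_right assms(2) by auto
  have lr: "\<not> e_free e l" "e_atom e r" and st: "e_flat e s" "e_atom e t"
    using oriented_flat_eqn superposition_right l s unfolding good_Eq_iff by blast+
  have "\<not> e_free e (subt_at s p)" using lr superposition_right E_e_free_iff by blast
  then have "e_flat e (replace_at s p r)" using e_flat_replace_at st lr superposition_right by blast
  moreover have "\<forall>q \<in> B. \<forall>t \<in> set_uprod q. e_free e t \<and> t \<in> G"
    using superposition_right l s ground_trms_subt_at E_constraints unfolding good_Eq_iff by blast
  moreover have "replace_at s p r \<in> G"
    using superposition_right l s ground_trms_replace_at unfolding good_Eq_iff by blast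
  ultimately show ?thesis
    using l s st unfolding superposition_right(1) good_Eq_iff e_flat_Eq_iff by blast
next
  case (superposition_left l r C s t D p B)
  have l: "good (Eq (Upair l r) \<parallel> C)" and s: "good (Neq (Upair s t) \<parallel> D)"
    using superposition_left assms(2) by auto
  have lr: "\<not> e_free e l" "e_atom e r"
    using oriented_flat_eqn superposition_left l unfolding good_Eq_iff by blast+
  have "\<not> e_free e (subt_at s p)" using lr superposition_left E_e_free_iff by blast
  then have "e_atom e (replace_at s p r)"
    using e_atom_replace_at s lr superposition_left unfolding good_Neq_iff by blast
  moreover have "\<forall>q \<in> B. \<forall>t \<in> set_uprod q. e_free e t \<and> t \<in> G"
    using superposition_left l s ground_trms_subt_at E_constraints
    unfolding good_Eq_iff good_Neq_iff by blast
  moreover have "replace_at s p r \<in> G"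
    using superposition_left l s ground_trms_replace_at unfolding good_Eq_iff good_Neq_iff by blast
  ultimately show ?thesis
    using l s unfolding superposition_left(1) good_Eq_iff good_Neq_iff by blast
next
  case (reflexion t u C B)
  have s: "good (Neq (Upair t u) \<parallel> C)" using reflexion assms(2) by auto
  then have "\<forall>q \<in> B. \<forall>t \<in> set_uprod q. e_free e t \<and> t \<in> G"
    using reflexion E_constraints unfolding good_Neq_iff by blast
  then show ?thesis using reflexion s unfolding good_Neq_iff by (auto simp: good_def trms_lit_def)
qed

lemma demod_good:
  assumes "demod e gt K N K'" "good K" "good N"
  shows "good K'"
  using assms(1)
proof cases
  case (1 x t L L' D C)
  have t: "t \<in> G" "e_atom e t"
    using assms(3) \<open>e_free e t\<close> unfolding 1(2) good_Eq_iff e_atom_def by blast+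
  have x: "\<not> e_free e (Var x)" using \<open>x \<in> e\<close> by (rule not_e_free_Var)
  from 1(7) show ?thesis
  proof cases
    case s: (1 s p u)
    have g: "e_flat_lit e (Eq (Upair s u))" "s \<in> G" "u \<in> G"
        "\<forall>q \<in> C. \<forall>t \<in> set_uprod q. e_free e t \<and> t \<in> G"
      using assms(2) unfolding 1(1) s(1) good_Eq_iff by blast+
    have "e_flat_lit e (Eq (Upair (replace_at s p t) u))"
      using g(1) e_flat_replace_at[of e s p t] e_atom_replace_at[of e s p t] s(3,4) t(2) x
      unfolding e_flat_Eq_iff by auto
    then show ?thesis unfolding 1(3) s(2) good_Eq_iff
      using g ground_trms_replace_at[OF t(1) g(2) s(3)] by blast
  next
    case s: (2 s p u)
    have g: "e_atom e s" "e_atom e u" "s \<in> G" "u \<in> G"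
        "\<forall>q \<in> C. \<forall>t \<in> set_uprod q. e_free e t \<and> t \<in> G"
      using assms(2) unfolding 1(1) s(1) good_Neq_iff by blast+
    have "e_atom e (replace_at s p t)" using e_atom_replace_at[of e s p t] s(3,4) t(2) x g(1) by auto
    then show ?thesis unfolding 1(3) s(2) good_Neq_iff
      using g ground_trms_replace_at[OF t(1) g(3) s(3)] by blast
  qed
qed

lemma step_good:
  assumes "step e gt S S'" "\<forall>K \<in> S. good K"
  shows "\<forall>K \<in> S'. good K"
  using assms(1)
proof cases
  case (demodulate K K')
  then show ?thesis using assms(2) demod_good unfolding demod_by_def by blast
next
  case (infer K)
  then show ?thesis using assms(2) inference_good by blast
qed

text \<open>A self-demodulation would be a case of the last condition of \<open>demod\<close> with
  equal right-hand sides, giving \<open>gt t t\<close>.\<close>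

lemma demod_irrefl:
  assumes "good K"
  shows "\<not> demod e gt K K K'"
proof
  assume "demod e gt K K K'"
  then show False
  proof cases
    case (1 x t L L' D C)
    then have "gt t t" by auto
    moreover have "t \<in> G" using assms unfolding 1(2) good_Eq_iff by blast
    ultimately show False using gt_irrefl by blast
  qed
qed

text \<open>A demodulated literal is recovered from its result and the demodulating equation, which
  remains present because no literal demodulates itself.\<close>

lemma step_complete:
  assumes "step e gt S S'" "\<forall>K \<in> S. good K" "\<forall>K \<in> S'. holds I \<sigma> K"
  shows "\<forall>K \<in> S. holds I \<sigma> K"
  using assms(1)
proof cases
  case (demodulate K K')
  then obtain N where N: "N \<in> S" "demod e gt K N K'" by (auto simp: demod_by_def)
  have "N \<noteq> K" using N demod_irrefl assms(2) by blast
  then have "holds I \<sigma> N" "holds I \<sigma> K'" using N demodulate assms(3) by auto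
  then have "holds I \<sigma> K" using demod_holds_iff[OF N(2)] by blast
  then show ?thesis using demodulate assms(3) by auto
next
  case (infer K)
  then show ?thesis using assms(3) by blast
qed

text \<open>Both directions of the equivalence matter: from input to saturated set it shows that the
  output is implied, and backwards it shows that the extended model satisfies the input.\<close>

lemma steps_preserve:
  assumes "(step e gt)\<^sup>*\<^sup>* S S'" "\<forall>K \<in> S. good K"
  shows "(\<forall>K \<in> S'. good K) \<and> ((\<forall>K \<in> S'. holds I \<sigma> K) \<longleftrightarrow> (\<forall>K \<in> S. holds I \<sigma> K))"
  using assms
proof (induction rule: rtranclp_induct)
  case (step S1 S2)
  then have g: "\<forall>K \<in> S1. good K" by blast
  have "(\<forall>K \<in> S2. holds I \<sigma> K) \<longleftrightarrow> (\<forall>K \<in> S1. holds I \<sigma> K)"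
    using step_sound[OF step.hyps(2)] step_complete[OF step.hyps(2) g] by (rule iffI[rotated])
  then show ?case using step_good[OF step.hyps(2) g] step.IH step.prems by simp
qed simp

end

section \<open>Extending a model of the output\<close>

text \<open>The last assumption is the truth of the output formula, expressed on the e-free members
  of \<open>S\<close>.\<close>

locale saturated_model = flat_calculus \<Sigma> e y gt
  for \<Sigma> :: "'f signature" and e y :: "'v set" and gt +
  fixes S :: "('f, 'v) clit set" and I :: "'f \<Rightarrow> 'a list \<Rightarrow> 'a" and \<sigma> :: "'v \<Rightarrow> 'a"
  assumes good_S: "K \<in> S \<Longrightarrow> good K"
    and saturated_S: "saturated e gt S"
    and e_free_holds: "K \<in> S \<Longrightarrow> e_free_clit e K \<Longrightarrow> holds I \<sigma> K"
begin

section \<open>Active literals and the semantic content of saturation\<close>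

definition active :: "('f, 'v) lit \<Rightarrow> bool" where
  "active L \<longleftrightarrow> (\<exists>C. L \<parallel> C \<in> S \<and> (\<forall>q \<in> C. sat_eqn I \<sigma> q))"

text \<open>More general than a demodulator: \<open>r\<close> may also be another variable of
  \<open>e\<close>.\<close>

definition rule :: "'v \<Rightarrow> ('f, 'v) trm \<Rightarrow> bool" where
  "rule x r \<longleftrightarrow> x \<in> e \<and> gt (Var x) r \<and> active (Eq (Upair (Var x) r))"

definition dem :: "('f, 'v) lit \<Rightarrow> ('f, 'v) lit \<Rightarrow> bool" where
  "dem L L' \<longleftrightarrow> (\<exists>x r. rule x r \<and> rewrite_lit (Var x) r L L')"

lemma active_good:
  assumes "active L"
  shows "L = Bot \<or> e_flat_lit e L" "trms_lit L \<subseteq> G"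
proof -
  obtain C where "L \<parallel> C \<in> S" using assms by (auto simp: active_def)
  then have "good (L \<parallel> C)" by (rule good_S)
  then show "L = Bot \<or> e_flat_lit e L" "trms_lit L \<subseteq> G" by (auto simp: good_def)
qed

lemma active_in_G: "active (Eq (Upair s t)) \<Longrightarrow> s \<in> G \<and> t \<in> G"
  and active_flat: "active (Eq (Upair s t)) \<Longrightarrow> e_flat_lit e (Eq (Upair s t))"
  using active_good[of "Eq (Upair s t)"] by (auto simp: trms_lit_def)

lemma active_e_free: "active L \<Longrightarrow> e_free_lit e L \<Longrightarrow> sat I \<sigma> (qf_of_lit L)"
  using e_free_holds by (fastforce simp: active_def holds_def)

lemma active_oriented:
  assumes "active (Eq (Upair s t))" "gt s t" "\<not> e_free e s"
  shows "e_flat e s" "e_atom e t" "s \<in> G" "t \<in> G"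
proof -
  have "\<not> e_free_lit e (Eq (Upair s t))" using assms(3) by (auto simp: e_free_lit_def trms_lit_def)
  moreover show st: "s \<in> G" "t \<in> G" using active_in_G[OF assms(1)] by blast+
  ultimately show "e_flat e s" "e_atom e t"
    using oriented_flat_eqn[OF assms(2) st active_flat[OF assms(1)]] by blast+
qed

lemma active_commute:
  "active (Eq (Upair a b)) \<longleftrightarrow> active (Eq (Upair b a))"
  "active (Neq (Upair a b)) \<longleftrightarrow> active (Neq (Upair b a))"
proof -
  have "Upair a b = Upair b a" by simp
  then show "active (Eq (Upair a b)) \<longleftrightarrow> active (Eq (Upair b a))"
    "active (Neq (Upair a b)) \<longleftrightarrow> active (Neq (Upair b a))" by metis+
qed

lemma rule_atom:
  assumes "rule x r"
  shows "e_atom e r" "r \<in> G" "x \<in> e" "gt (Var x) r"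
  using assms active_oriented[of "Var x" r] not_e_free_Var[of x e] unfolding rule_def by blast+

text \<open>Demodulation leaves the constraint \<open>C\<close> unchanged and uses only equations
  whose constraints lie in \<open>C\<close>. If \<open>C\<close> is true, all of them are active,
  and so is the literal of \<open>S\<close> in which the chain ends.\<close>

lemma active_inference:
  assumes "inference e gt S (L \<parallel> C)" "\<forall>q \<in> C. sat_eqn I \<sigma> q"
  shows "\<exists>L'. active L' \<and> dem\<^sup>*\<^sup>* L L'"
proof -
  obtain K' where K': "K' \<in> S" "(demod_by e gt S)\<^sup>*\<^sup>* (L \<parallel> C) K'"
    using saturated_S assms(1) unfolding saturated_def by blast
  from K'(2) have "cnstr K' = C \<and> dem\<^sup>*\<^sup>* L (lit K')"
  proof (induction rule: rtranclp_induct)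
    case (step K1 K2)
    obtain N where N: "N \<in> S" "demod e gt K1 N K2" using step by (auto simp: demod_by_def)
    from N(2) have "cnstr K2 = C \<and> dem (lit K1) (lit K2)"
    proof cases
      case (1 x t L L' D C')
      then have "C' = C" using step by simp
      then have "rule x t" using 1 N(1) assms(2) unfolding rule_def active_def by blast
      then show ?thesis using 1 \<open>C' = C\<close> unfolding dem_def by auto
    qed
    then show ?case using step by auto
  qed simp
  then show ?thesis using K'(1) assms(2) by (cases K') (auto simp: active_def)
qed

lemma active_superposition_right:
  assumes "active (Eq (Upair l r))" "gt l r" "\<not> e_free e l"
    and "active (Eq (Upair s t))" "gt s t" "\<not> e_free e s"
    and "is_pos s p" "E e (subt_at s p) l B" "\<forall>q \<in> B. sat_eqn I \<sigma> q"
  shows "\<exists>L'. active L' \<and> dem\<^sup>*\<^sup>* (Eq (Upair (replace_at s p r) t)) L'"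
proof -
  obtain C D where "Eq (Upair l r) \<parallel> C \<in> S" "\<forall>q \<in> C. sat_eqn I \<sigma> q"
      "Eq (Upair s t) \<parallel> D \<in> S" "\<forall>q \<in> D. sat_eqn I \<sigma> q"
    using assms unfolding active_def by blast
  moreover have "\<not> e_free_lit e (Eq (Upair l r))" "\<not> e_free_lit e (Eq (Upair s t))"
    using assms by (auto simp: e_free_lit_def trms_lit_def)
  ultimately show ?thesis using assms
    by (intro active_inference[where C = "C \<union> D \<union> B"] superposition_right) auto
qed

text \<open>Sides of disequations are atoms, so the overlaps of interest are at the root of a
  variable, where \<open>E\<close> returns the empty constraint.\<close>

lemma active_superposition_left:
  assumes "rule x r" "active (Neq (Upair (Var x) t))" "gt (Var x) t"
  shows "\<exists>L'. active L' \<and> dem\<^sup>*\<^sup>* (Neq (Upair r t)) L'"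
proof -
  obtain C D where "Eq (Upair (Var x) r) \<parallel> C \<in> S" "\<forall>q \<in> C. sat_eqn I \<sigma> q"
      "Neq (Upair (Var x) t) \<parallel> D \<in> S" "\<forall>q \<in> D. sat_eqn I \<sigma> q"
    using assms unfolding rule_def active_def by blast
  moreover have "\<not> e_free_lit e (Eq (Upair (Var x) r))" "\<not> e_free_lit e (Neq (Upair (Var x) t))"
    using assms by (auto simp: e_free_lit_def trms_lit_def rule_def not_e_free_Var)
  ultimately have "\<exists>L'. active L' \<and> dem\<^sup>*\<^sup>* (Neq (Upair (replace_at (Var x) [] r) t)) L'"
    using assms by (intro active_inference[where C = "C \<union> D \<union> {}"] superposition_left)
      (auto simp: rule_def intro: E.same)
  then show ?thesis by simp
qed

text \<open>Values of flat atoms in the extension: elements of the given model, and the irreducible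
  variables of \<open>e\<close> as new elements.\<close>

inductive nf :: "('f, 'v) trm \<Rightarrow> 'a + 'v \<Rightarrow> bool" where
  nf_free: "e_free e t \<Longrightarrow> nf t (Inl (trm_val I \<sigma> t))"
| nf_irreducible: "x \<in> e \<Longrightarrow> (\<And>r. \<not> rule x r) \<Longrightarrow> nf (Var x) (Inr x)"
| nf_rule: "rule x r \<Longrightarrow> nf r w \<Longrightarrow> nf (Var x) w"

text \<open>The description is justified on ground atoms by \<open>nf_unique\<close>.\<close>

definition v :: "('f, 'v) trm \<Rightarrow> 'a + 'v" where "v t = (THE w. nf t w)"

lemma nf_e_free_iff: "e_free e t \<Longrightarrow> nf t w \<longleftrightarrow> w = Inl (trm_val I \<sigma> t)"
  by (auto elim: nf.cases intro: nf_free dest: not_e_free_Var rule_atom)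

lemma nf_rule_v_eq:
  assumes "rule x r" "\<exists>!w. nf (Var x) w" "\<exists>!w. nf r w"
  shows "v (Var x) = v r"
  using assms nf_rule unfolding v_def by (metis theI')

lemma dem_cases_atoms:
  assumes "dem (Eq (Upair a b)) L'" "e_atom e a" "e_atom e b"
  obtains x r where "rule x r" "a = Var x" "L' = Eq (Upair r b)"
  | x r where "rule x r" "b = Var x" "L' = Eq (Upair r a)"
proof -
  obtain x r where x: "rule x r" "rewrite_lit (Var x) r (Eq (Upair a b)) L'"
    using assms by (auto simp: dem_def)
  have *: "c = Var x \<and> replace_at c p r = r"
    if "e_atom e c" "is_pos c p" "subt_at c p = Var x" for c p
  proof -
    have "\<not> e_free e (subt_at c p)"
      using that(3) rule_atom(3)[OF x(1)] not_e_free_Var by simp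
    with e_flat_if_e_atom[OF that(1)] that(2) show ?thesis
    proof (cases rule: e_flat_pos_cases)
      case (2 f us i z)
      then have "\<not> e_free e c" using \<open>\<not> e_free e (subt_at c p)\<close> e_free_subt_at that(2) by blast
      then show ?thesis using that(1) 2 by (auto simp: e_atom_def)
    qed (use that in simp)
  qed
  from x(2) show ?thesis
  proof cases
    case (1 t p u)
    then have "t = a \<and> u = b \<or> t = b \<and> u = a" by auto
    then show ?thesis using that x(1) *[of t p] 1 assms(2,3) by auto
  qed
qed

text \<open>Existence is descent along rules. For uniqueness, two rules for one variable are
  superposed at the root: their right-hand sides must have equal values, since otherwise an active
  equation between smaller atoms of different values would remain.\<close>

lemma nf_unique:
  assumes "t \<in> G" "e_atom e t"
  shows "\<exists>!w. nf t w"
  using assms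
proof (induction t rule: gt_induct)
  case (less t)
  have IH: "\<exists>!w. nf u w" if "u \<in> G" "gt t u" "e_atom e u" for u
    using less.IH[OF that(1,2)] that(3) by blast
  show ?case
  proof (cases "e_free e t")
    case True
    then show ?thesis by (simp add: nf_e_free_iff)
  next
    case False
    then obtain x where x: "x \<in> e" "t = Var x" using less.prems by (auto simp: e_atom_def)
    show ?thesis
    proof (cases "\<exists>r. rule x r")
      case False
      then have "nf (Var x) w \<longleftrightarrow> w = Inr x" for w
        using x by (auto elim: nf.cases intro: nf_irreducible dest: not_e_free_Var)
      then show ?thesis using x by simp
    next
      case True
      then obtain r where r: "rule x r" by blast
      have below: "\<exists>!w. nf r' w" if "rule x r'" for r' 
        using IH[of r'] rule_atom[OF that] x by simp
      have confluent: "v r1 = v r2" if r12: "rule x r1" "rule x r2" for r1 r2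
      proof (rule ccontr)
        assume neq: "v r1 \<noteq> v r2"
        \<comment> \<open>\<open>Q\<close> describes a smaller counterexample; \<open>Q_step\<close>
          shows that it survives demodulation, so it reaches the active literal
          \<open>L'\<close>.\<close>
        define Q where "Q L \<longleftrightarrow> (\<exists>a b. L = Eq (Upair a b) \<and> a \<in> G \<and> b \<in> G \<and> gt t a \<and> gt t b \<and>
          e_atom e a \<and> e_atom e b \<and> v a \<noteq> v b)" for L
        have "\<exists>L'. active L' \<and> dem\<^sup>*\<^sup>* (Eq (Upair (replace_at (Var x) [] r1) r2)) L'"
          using r12 x not_e_free_Var[of x e]
          by (intro active_superposition_right[where l = "Var x" and B = "{}"])
            (auto simp: rule_def intro: E.same)
        then obtain L' where L': "active L'" "dem\<^sup>*\<^sup>* (Eq (Upair r1 r2)) L'" by auto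
        have step: "v (Var z) = v s \<and> s \<in> G \<and> gt t s \<and> e_atom e s" if "rule z s" "gt t (Var z)" for z s
        proof -
          note s = rule_atom[OF that(1)]
          have gt: "gt t s" by (rule gt_trans[OF less.hyps Var_in_G[OF s(3)] s(2) that(2) s(4)])
          have "\<exists>!w. nf (Var z) w" using IH[OF Var_in_G[OF s(3)] that(2)] s(3) by (simp add: e_atom_def)
          then show ?thesis using nf_rule_v_eq[OF that(1) _ IH[OF s(2) gt s(1)]] s gt by blast
        qed
        have Q_step: "Q L2" if dem12: "dem L1 L2" and Q1: "Q L1" for L1 L2
        proof -
          obtain a b where ab: "L1 = Eq (Upair a b)" "a \<in> G" "b \<in> G" "gt t a" "gt t b"
              "e_atom e a" "e_atom e b" "v a \<noteq> v b"
            using Q1 by (auto simp: Q_def)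
          have "dem (Eq (Upair a b)) L2" using dem12 ab by simp
          then show ?thesis using ab(6,7)
          proof (cases rule: dem_cases_atoms)
            case (1 z s)
            then show ?thesis using step[OF 1(1)] ab unfolding Q_def by auto
          next
            case (2 z s)
            then show ?thesis using step[OF 2(1)] ab unfolding Q_def by auto
          qed
        qed
        have "Q (Eq (Upair r1 r2))"
          using rule_atom[OF r12(1)] rule_atom[OF r12(2)] neq x unfolding Q_def by blast
        with L'(2) have "Q L'" by (induction rule: rtranclp_induct) (auto intro: Q_step)
        then obtain a b where ab: "L' = Eq (Upair a b)" "a \<in> G" "b \<in> G" "gt t a" "gt t b"
            "e_atom e a" "e_atom e b" "v a \<noteq> v b"
          by (auto simp: Q_def)
        \<comment> \<open>The larger side is a variable of \<open>e\<close> below \<open>t\<close>,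
          so the equation is itself a rule, and the induction hypothesis makes its two sides
          agree.\<close>
        have *: False if a: "active (Eq (Upair a b))" "gt a b" "gt t a" "e_atom e a"
            "v a \<noteq> v b" "\<not> e_free e a" for a b
        proof -
          obtain z where "z \<in> e" "a = Var z" using a by (auto simp: e_atom_def)
          then show False using step[of z b] a by (auto simp: rule_def)
        qed
        show False
        proof (cases "e_free e a \<and> e_free e b")
          case True
          then have "sat I \<sigma> (qf_of_lit L')"
            using active_e_free[OF L'(1)] ab by (simp add: e_free_lit_def trms_lit_def)
          then have "v a = v b" using True ab nf_e_free_iff by (simp add: v_def)
          then show False using ab by blast
        next
          case False
          have nfl: "\<not> e_free_lit e (Eq (Upair a b))" "\<not> e_free_lit e (Eq (Upair b a))"
            using False by (auto simp: e_free_lit_def trms_lit_def)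
          have act: "active (Eq (Upair a b))" "active (Eq (Upair b a))"
            using L'(1) active_commute(1)[of a b] unfolding ab(1) by blast+
          have "gt a b \<or> gt b a" using gt_total ab by blast
          then show False
          proof
            assume gt: "gt a b"
            show False
              by (rule *[OF act(1) gt ab(4,6,8)
                    oriented_flat_eqn(1)[OF gt ab(2,3) active_flat[OF act(1)] nfl(1)]])
          next
            assume gt: "gt b a"
            show False
              by (rule *[OF act(2) gt ab(5,7) ab(8)[symmetric]
                    oriented_flat_eqn(1)[OF gt ab(3,2) active_flat[OF act(2)] nfl(2)]])
          qed
        qed
      qed
      have nf_v: "nf r' (v r')" and nf_eq: "nf r' w \<Longrightarrow> w = v r'" if "rule x r'" for r' w
        using theI'[OF below[OF that]] below[OF that] unfolding v_def by auto
      have "w = v r" if "nf (Var x) w" for w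
        using that
      proof cases
        case nf_free
        then show ?thesis using x(1) by (simp add: e_free_def)
      next
        case nf_irreducible
        then show ?thesis using r by simp
      next
        case (nf_rule r')
        have "w = v r'" by (rule nf_eq[OF nf_rule])
        also have "\<dots> = v r" by (rule confluent[OF nf_rule(1) r])
        finally show ?thesis .
      qed
      moreover have "nf (Var x) (v r)" by (rule nf_rule[OF r nf_v[OF r]])
      ultimately show ?thesis unfolding x(2) by (intro ex1I)
    qed
  qed
qed

lemma v_rule: "rule x r \<Longrightarrow> v (Var x) = v r"
  by (rule nf_rule_v_eq) (auto intro!: nf_unique Var_in_G dest: rule_atom simp: e_atom_def)

lemma v_e_free: "e_free e t \<Longrightarrow> v t = Inl (trm_val I \<sigma> t)"
  by (simp add: v_def nf_e_free_iff)

lemma v_irreducible: "x \<in> e \<Longrightarrow> (\<And>r. \<not> rule x r) \<Longrightarrow> v (Var x) = Inr x"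
  unfolding v_def
  by (rule the1_equality) (auto intro!: nf_unique nf_irreducible Var_in_G simp: e_atom_def)

text \<open>Every use of a rule descends in the ordering, so the new element of \<open>z\<close> is
  reached only from \<open>Var z\<close> and from larger terms. This later separates an irreducible
  variable from all smaller atoms.\<close>

lemma nf_Inr: "nf t (Inr z) \<Longrightarrow> z \<in> e \<and> (t = Var z \<or> gt t (Var z))"
proof (induction t "Inr z :: 'a + 'v" rule: nf.induct)
  case (nf_rule x r)
  then show ?case using rule_atom[of x r] gt_trans Var_in_G by blast
qed auto

lemma v_Inr:
  assumes "v t = Inr z" "t \<in> G" "e_atom e t"
  shows "t = Var z \<or> gt t (Var z)"
  using nf_Inr theI'[OF nf_unique[OF assms(2,3)]] assms(1) unfolding v_def by metis

section \<open>Interpreting symbols and variables in the extension\<close>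

definition irreducible :: "('f, 'v) trm \<Rightarrow> bool" where
  "irreducible u \<longleftrightarrow> (\<forall>x r. u = Var x \<longrightarrow> \<not> rule x r)"

text \<open>Old arguments keep the old interpretation. Elsewhere an active equation is chosen whose
  irreducible arguments have the given values; coherence of the choice is left to
  \<open>active_Eq_oriented\<close>. If there is none, the value is arbitrary and no active equation
  with irreducible arguments refers to it.\<close>

definition J :: "'f \<Rightarrow> ('a + 'v) list \<Rightarrow> 'a + 'v" where
  "J f ws = (if \<forall>w \<in> set ws. isl w then Inl (I f (map projl ws))
     else v (SOME b. \<exists>us. active (Eq (Upair (Fun f us) b)) \<and> gt (Fun f us) b \<and>
       (\<forall>u \<in> set us. e_atom e u \<and> irreducible u) \<and> map v us = ws))"

definition \<tau> :: "'v \<Rightarrow> 'a + 'v" where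
  "\<tau> x = (if x \<in> e then v (Var x) else Inl (\<sigma> x))"

lemma trm_val_J_e_free: "e_free e t \<Longrightarrow> trm_val J \<tau> t = Inl (trm_val I \<sigma> t)"
proof (induction t)
  case (Fun f ts)
  then have "map (trm_val J \<tau>) ts = map (Inl \<circ> trm_val I \<sigma>) ts" by (auto simp: e_free_def)
  moreover have "J f (map (Inl \<circ> trm_val I \<sigma>) ts) = Inl (I f (map (trm_val I \<sigma>) ts))"
    by (simp add: J_def comp_def)
  ultimately show ?case by (simp only: trm_val.simps)
qed (simp add: \<tau>_def e_free_def)

lemma trm_val_J_e_atom: "e_atom e t \<Longrightarrow> trm_val J \<tau> t = v t"
  by (auto simp: e_atom_def trm_val_J_e_free v_e_free \<tau>_def)

lemma \<tau>_in_e: "x \<in> e \<Longrightarrow> \<tau> x = v (Var x)"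
  by (simp add: \<tau>_def)

text \<open>\<open>\<tau>\<close> agrees with \<open>\<sigma>\<close> outside \<open>e\<close>, so
  this covers formulas with arbitrary further variables.\<close>

lemma sat_J_e_free:
  "vars_qf F \<inter> e = {} \<Longrightarrow> sat J \<tau> F \<longleftrightarrow> sat I \<sigma> F"
proof (induction F)
  case (Atom q)
  then show ?case
    by (cases q) (auto simp: vars_eqn_def trm_val_J_e_free e_free_def Int_Un_distrib2)
qed (auto simp: Int_Un_distrib2)

lemma sat_J_dems: "dem\<^sup>*\<^sup>* L L' \<Longrightarrow> sat J \<tau> (qf_of_lit L') \<longleftrightarrow> sat J \<tau> (qf_of_lit L)"
proof (induction rule: rtranclp_induct)
  case (step L1 L2)
  then obtain x r where x: "rule x r" "rewrite_lit (Var x) r L1 L2" by (auto simp: dem_def)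
  have "trm_val J \<tau> (Var x) = trm_val J \<tau> r"
    using rule_atom[OF x(1)] v_rule[OF x(1)] trm_val_J_e_atom by (simp add: \<tau>_in_e)
  then show ?case using sat_rewrite_lit[OF x(2)] step by blast
qed simp

section \<open>Truth of active equations\<close>

definition below :: "('f, 'v) trm \<Rightarrow> ('f, 'v) trm set" where
  "below s = {t \<in> G. gt s t}"

text \<open>Makes induction hypotheses available for the literal that saturation supplies after an
  inference and its demodulations.\<close>

lemma dems_below:
  assumes "dem\<^sup>*\<^sup>* L L'" "trms_lit L \<subseteq> below s" "s \<in> G"
  shows "trms_lit L' \<subseteq> below s"
  using assms(1)
proof (induction rule: rtranclp_induct)
  case base
  then show ?case by (rule assms)
next
  case (step L1 L2)
  then obtain x r where x: "rule x r" "rewrite_lit (Var x) r L1 L2" by (auto simp: dem_def)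
  have *: "replace_at t p r \<in> below s" if "t \<in> below s" "is_pos t p" "subt_at t p = Var x" for t p
  proof -
    have "replace_at t p r \<in> G" "gt t (replace_at t p r)"
      using that rule_atom[OF x(1)] ground_trms_replace_at gt_replace_at by (auto simp: below_def)
    then show ?thesis using that gt_trans assms(3) unfolding below_def by blast
  qed
  from x(2) show ?case by cases (use step(3) * in \<open>auto simp: trms_lit_def\<close>)
qed

lemma dems_Eq: "dem\<^sup>*\<^sup>* (Eq q) L' \<Longrightarrow> \<exists>q'. L' = Eq q'"
  by (induction rule: rtranclp_induct) (auto simp: dem_def elim: rewrite_lit.cases)

lemma dems_Neq: "dem\<^sup>*\<^sup>* (Neq q) L' \<Longrightarrow> \<exists>q'. L' = Neq q'"
  by (induction rule: rtranclp_induct) (auto simp: dem_def elim: rewrite_lit.cases)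

text \<open>Irreducible variables of \<open>e\<close> have pairwise distinct new values. Hence
  arguments of equal value are identical or both e-free with equal old values, and \<open>E\<close>
  collects only true constraints.\<close>

lemma E_irreducible_args:
  assumes "\<not> e_free e (Fun f us)" "\<forall>u \<in> set us. e_atom e u \<and> irreducible u"
    and "\<forall>u \<in> set us'. e_atom e u \<and> irreducible u" "map v us' = map v us"
  shows "\<not> e_free e (Fun f us') \<and>
    (\<exists>B. E e (Fun f us) (Fun f us') B \<and> (\<forall>q \<in> B. sat_eqn I \<sigma> q))"
proof -
  have len: "length us' = length us" using assms(4) map_eq_imp_length_eq by blast
  have arg: "us ! i = us' ! i \<or> e_free e (us ! i) \<and> e_free e (us' ! i) \<and>
      trm_val I \<sigma> (us ! i) = trm_val I \<sigma> (us' ! i)" if i: "i < length us" for i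
  proof -
    have a: "e_atom e (us ! i)" "irreducible (us ! i)" "e_atom e (us' ! i)" "irreducible (us' ! i)"
      using assms(2,3) i len by auto
    have eq: "v (us ! i) = v (us' ! i)" using assms(4) i len by (metis nth_map)
    have *: "\<exists>x \<in> e. t = Var x \<and> v t = Inr x" if "e_atom e t" "irreducible t" "\<not> e_free e t" for t
      using that v_irreducible by (auto simp: e_atom_def irreducible_def)
    show ?thesis
    proof (cases "e_free e (us ! i)")
      case True
      then show ?thesis using *[of "us' ! i"] a eq v_e_free by (metis sum.distinct(1) sum.inject(1))
    next
      case False
      then show ?thesis using *[of "us ! i"] *[of "us' ! i"] a eq v_e_free
        by (metis sum.distinct(1) sum.inject(2))
    qed
  qed
  \<comment> \<open>An argument that is not e-free is shared by both terms, which makes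
    \<open>E.args\<close> applicable.\<close>
  obtain i where "i < length us" "\<not> e_free e (us ! i)"
    using assms(1) by (fastforce simp: e_free_def in_set_conv_nth)
  then have "us' ! i \<in> set us'" "\<not> e_free e (us' ! i)" using arg len by (force)+
  then have nf': "\<not> e_free e (Fun f us')" by (auto simp: e_free_def)
  have "\<exists>B. E e (us ! i) (us' ! i) B \<and> (\<forall>q \<in> B. sat_eqn I \<sigma> q)" if "i < length us" for i
  proof (cases "us ! i = us' ! i")
    case True
    then show ?thesis using E.same[of e "us ! i"] by (intro exI[of _ "{}"]) simp
  next
    case False
    then show ?thesis using arg[OF that] E.free[of "us ! i" "us' ! i" e]
      by (intro exI[of _ "{Upair (us ! i) (us' ! i)}"]) simp
  qed
  then obtain B where B: "\<And>i. i < length us \<Longrightarrow> E e (us ! i) (us' ! i) (B i)"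
      "\<And>i. i < length us \<Longrightarrow> \<forall>q \<in> B i. sat_eqn I \<sigma> q"
    by metis
  have "E e (Fun f us) (Fun f us') (\<Union> (set (map B [0..<length us])))"
    using assms(1) nf' len B(1) by (intro E.args) auto
  moreover have "\<forall>q \<in> \<Union> (set (map B [0..<length us])). sat_eqn I \<sigma> q" using B(2) by auto
  ultimately show ?thesis using nf' by blast
qed

lemma active_Eq_below:
  assumes "\<And>s t. s \<in> below u \<Longrightarrow> active (Eq (Upair s t)) \<Longrightarrow> gt s t \<Longrightarrow> trm_val J \<tau> s = trm_val J \<tau> t"
    and "active L" "trms_lit L \<subseteq> below u" "L = Eq q"
  shows "sat J \<tau> (qf_of_lit L)"
proof (cases q)
  case (Upair a b)
  have ab: "a \<in> below u" "b \<in> below u" using assms Upair by (auto simp: trms_lit_def)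
  have act: "active (Eq (Upair a b))" "active (Eq (Upair b a))"
    using assms(2) active_commute(1)[of a b] unfolding assms(4) Upair by blast+
  have "a = b \<or> gt a b \<or> gt b a" using gt_total ab by (auto simp: below_def)
  then have "trm_val J \<tau> a = trm_val J \<tau> b" using assms(1)[OF _ act(1)] assms(1)[OF _ act(2)] ab by auto
  then show ?thesis using assms Upair by simp
qed

text \<open>An e-free equation is true in the given model, and a variable has its value by
  \<open>v_rule\<close>. A function term is superposed with a rule for a reducible argument, or at
  the root with the equation chosen by \<open>J\<close>; the resulting literal is smaller.\<close>

lemma active_Eq_oriented:
  assumes "s \<in> G" "active (Eq (Upair s t))" "gt s t"
  shows "trm_val J \<tau> s = trm_val J \<tau> t"
  using assms
proof (induction s arbitrary: t rule: gt_induct)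
  case (less s)
  note act = less.prems(1) and gt = less.prems(2)
  have IH: "sat J \<tau> (qf_of_lit L)" if "active L" "trms_lit L \<subseteq> below s" "L = Eq q" for L q
    by (rule active_Eq_below[OF _ that]) (use less.IH in \<open>simp add: below_def\<close>)
  have t: "t \<in> G" using act active_in_G by blast
  show ?case
  proof (cases "e_free_lit e (Eq (Upair s t))")
    case True
    then show ?thesis using active_e_free[OF act] trm_val_J_e_free
      by (auto simp: e_free_lit_def trms_lit_def)
  next
    case False
    then have s: "\<not> e_free e s" "e_flat e s" "e_atom e t"
      using oriented_flat_eqn[OF gt less.hyps t active_flat[OF act]] by auto
    consider x where "x \<in> e" "s = Var x" | f us where "s = Fun f us" "\<forall>u \<in> set us. e_atom e u"
      using s by (auto simp: e_flat_def)
    then show ?thesis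
    proof cases
      case 1
      then have "rule x t" using act gt by (simp add: rule_def)
      then have "v s = v t" using v_rule 1 by blast
      then show ?thesis using s 1 by (simp add: trm_val_J_e_atom \<tau>_in_e)
    next
      case (2 f us)
      show ?thesis
      proof (cases "\<forall>u \<in> set us. irreducible u")
        case False
        then obtain i x r where i: "i < length us" "us ! i = Var x" "rule x r"
          by (auto simp: irreducible_def in_set_conv_nth)
        \<comment> \<open>Overlapping the rule for \<open>x\<close> into the reducible argument
          produces sides below \<open>s\<close>; the truth of the result is carried back to
          \<open>s\<close> and \<open>t\<close> because rewriting with a rule preserves
          values.\<close>
        have "\<exists>L'. active L' \<and> dem\<^sup>*\<^sup>* (Eq (Upair (replace_at s [i] r) t)) L'"
          using i s 2 act gt rule_atom[OF i(3)] not_e_free_Var[of x e]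
          by (intro active_superposition_right[where l = "Var x" and B = "{}"])
            (auto simp: rule_def intro: E.same)
        then obtain L' where L': "active L'" "dem\<^sup>*\<^sup>* (Eq (Upair (replace_at s [i] r) t)) L'" by blast
        have pos: "is_pos s [i]" "subt_at s [i] = Var x" using i 2 by auto
        have r: "r \<in> G" "gt (Var x) r" using rule_atom i by blast+
        have "replace_at s [i] r \<in> below s" unfolding below_def
          using ground_trms_replace_at gt_replace_at less.hyps pos r by fastforce
        then have "trms_lit (Eq (Upair (replace_at s [i] r) t)) \<subseteq> below s"
          using t gt by (simp add: trms_lit_def below_def)
        then have "trms_lit L' \<subseteq> below s" using dems_below L'(2) less.hyps by blast
        then have "sat J \<tau> (qf_of_lit L')" using IH L' dems_Eq by blast
        then have "trm_val J \<tau> (replace_at s [i] r) = trm_val J \<tau> t" using sat_J_dems[OF L'(2)] by simp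
        moreover have "trm_val J \<tau> (Var x) = trm_val J \<tau> r"
          using v_rule[OF i(3)] rule_atom[OF i(3)] trm_val_J_e_atom by (simp add: \<tau>_in_e)
        ultimately show ?thesis using trm_val_replace_at[OF pos(1)] pos(2) by metis
      next
        case True
        \<comment> \<open>The same predicate as in \<open>J\<close>, so that \<open>Eps P\<close> is
          the right-hand side selected there; the present equation shows that the choice is not
          void.\<close>
        define P where "P b \<longleftrightarrow> (\<exists>us'. active (Eq (Upair (Fun f us') b)) \<and> gt (Fun f us') b \<and>
          (\<forall>u \<in> set us'. e_atom e u \<and> irreducible u) \<and> map v us' = map v us)" for b
        have "P t" using act gt 2 True by (auto simp: P_def)
        then have "P (Eps P)" by (rule someI)
        then obtain us' where us': "active (Eq (Upair (Fun f us') (Eps P)))" "gt (Fun f us') (Eps P)"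
            "\<forall>u \<in> set us'. e_atom e u \<and> irreducible u" "map v us' = map v us"
          by (auto simp: P_def)
        obtain B where nf': "\<not> e_free e (Fun f us')"
            and B: "E e s (Fun f us') B" "\<forall>q \<in> B. sat_eqn I \<sigma> q"
          using E_irreducible_args[OF _ _ us'(3,4)] s 2 True by blast
        have b: "e_atom e (Eps P)" "Eps P \<in> G" using active_oriented us' nf' by blast+
        \<comment> \<open>A root overlap compares the selected value with \<open>t\<close>;
          \<open>us'\<close> may differ from \<open>us\<close>, and \<open>B\<close> accounts for
          the difference.\<close>
        have "\<exists>L'. active L' \<and> dem\<^sup>*\<^sup>* (Eq (Upair (replace_at s [] (Eps P)) t)) L'"
          using us' nf' act gt s B by (intro active_superposition_right) auto
        then obtain L' where L': "active L'" "dem\<^sup>*\<^sup>* (Eq (Upair (Eps P) t)) L'" by auto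
        \<comment> \<open>The selected equation bounds \<open>Eps P\<close> only by
          \<open>Fun f us'\<close>. The bound by \<open>s\<close> comes from the orientation
          condition: \<open>s\<close> is a function term that is not e-free and \<open>Eps P\<close>
          is an atom.\<close>
        have "gt s (Eps P)"
          using orients less.hyps s b 2(1) unfolding orients_flat_eqns_def e_atom_def by blast
        then have "trms_lit (Eq (Upair (Eps P) t)) \<subseteq> below s"
          using t gt b by (simp add: trms_lit_def below_def)
        then have "trms_lit L' \<subseteq> below s" using dems_below L'(2) less.hyps by blast
        then have "sat J \<tau> (qf_of_lit L')" using IH L' dems_Eq by blast
        then have "trm_val J \<tau> (Eps P) = trm_val J \<tau> t" using sat_J_dems[OF L'(2)] by simp
        moreover have "trm_val J \<tau> s = v (Eps P)"
        proof -
          have "map (trm_val J \<tau>) us = map v us" using 2 trm_val_J_e_atom by simp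
          \<comment> \<open>An argument that is not e-free is an irreducible variable with a new
            value, so the second branch of \<open>J\<close> applies.\<close>
          moreover have "\<not> (\<forall>w \<in> set (map v us). isl w)"
          proof -
            obtain u where u: "u \<in> set us" "\<not> e_free e u" using s(1) 2(1) by (auto simp: e_free_def)
            then have "\<exists>x. v u = Inr x"
              using 2 True v_irreducible by (auto simp: e_atom_def irreducible_def)
            then show ?thesis using u by force
          qed
          then have "J f (map v us) = v (Eps P)" unfolding J_def P_def by (rule if_not_P)
          ultimately show ?thesis unfolding 2(1) by (simp only: trm_val.simps)
        qed
        ultimately show ?thesis using trm_val_J_e_atom b by simp
      qed
    qed
  qed
qed

section \<open>Truth of active disequations and of the saturated set\<close>

lemma active_Neq_irrefl: "\<not> active (Neq (Upair t t))"
proof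
  assume act: "active (Neq (Upair t t))"
  then obtain C where C: "Neq (Upair t t) \<parallel> C \<in> S" "\<forall>q \<in> C. sat_eqn I \<sigma> q"
    by (auto simp: active_def)
  show False
  proof (cases "e_free_lit e (Neq (Upair t t))")
    case True
    then show False using active_e_free[OF act] by simp
  next
    case False
    \<comment> \<open>Reflexion makes \<open>Bot\<close> active; it admits no rewriting and is
      e-free, so it would have to be true in the given model.\<close>
    then have "inference e gt S (Bot \<parallel> (C \<union> {}))" using C by (intro reflexion) (auto intro: E.same)
    then obtain L' where L': "active L'" "dem\<^sup>*\<^sup>* Bot L'" using active_inference C by fastforce
    have "L' = Bot" using L'(2)
      by (induction rule: rtranclp_induct) (auto simp: dem_def elim: rewrite_lit.cases)
    then show False using active_e_free[OF L'(1)] by (simp add: e_free_lit_def trms_lit_def)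
  qed
qed

text \<open>An irreducible variable differs from every smaller atom by \<open>v_Inr\<close>. A
  reducible one is replaced by superposition, giving a disequation between smaller terms.\<close>

lemma active_Neq_oriented:
  assumes "s \<in> G" "active (Neq (Upair s t))" "gt s t"
  shows "trm_val J \<tau> s \<noteq> trm_val J \<tau> t"
  using assms
proof (induction s arbitrary: t rule: gt_induct)
  case (less s)
  note act = less.prems(1) and gt = less.prems(2)
  have st: "t \<in> G" "e_atom e s" "e_atom e t"
    using active_good[OF act] by (auto simp: trms_lit_def e_flat_Neq_iff)
  show ?case
  proof (cases "e_free e s")
    case True
    then have "e_free e t"
      using gt gt_asym less.hyps st orients e_flat_if_e_atom unfolding orients_flat_eqns_def by blast
    with True show ?thesis using active_e_free[OF act] trm_val_J_e_free
      by (auto simp: e_free_lit_def trms_lit_def)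
  next
    case False
    then obtain x where x: "x \<in> e" "s = Var x" using st by (auto simp: e_atom_def)
    show ?thesis
    proof (cases "\<exists>r. rule x r")
      case False
      then have "v s = Inr x" using v_irreducible x by blast
      moreover have "v t \<noteq> Inr x"
        using v_Inr[of t x] st gt x gt_asym gt_irrefl less.hyps by blast
      ultimately show ?thesis using trm_val_J_e_atom st by simp
    next
      case True
      then obtain r where r: "rule x r" by blast
      then obtain L' where L': "active L'" "dem\<^sup>*\<^sup>* (Neq (Upair r t)) L'"
        using active_superposition_left act gt x by blast
      have "trms_lit (Neq (Upair r t)) \<subseteq> below s"
        using st gt rule_atom[OF r] x by (simp add: trms_lit_def below_def)
      then have bel: "trms_lit L' \<subseteq> below s" using dems_below L'(2) less.hyps by blast
      obtain q where q: "L' = Neq q" using dems_Neq L' by blast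
      have "sat J \<tau> (qf_of_lit L')"
      proof (cases q)
        case (Upair a b)
        have ab: "a \<in> G" "b \<in> G" "gt s a" "gt s b"
          using bel q Upair by (auto simp: trms_lit_def below_def)
        have act': "active (Neq (Upair a b))" "active (Neq (Upair b a))"
          using L'(1) active_commute(2)[of a b] unfolding q Upair by blast+
        have "a \<noteq> b" using active_Neq_irrefl act' by blast
        then have "trm_val J \<tau> a \<noteq> trm_val J \<tau> b"
          using gt_total[OF ab(1,2)] less.IH ab act' by metis
        then show ?thesis using q Upair by simp
      qed
      then have "trm_val J \<tau> r \<noteq> trm_val J \<tau> t" using sat_J_dems[OF L'(2)] by simp
      then show ?thesis using v_rule[OF r] rule_atom[OF r] st x by (simp add: trm_val_J_e_atom \<tau>_in_e)
    qed
  qed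
qed

lemma active_Neq:
  assumes "active (Neq (Upair s t))"
  shows "trm_val J \<tau> s \<noteq> trm_val J \<tau> t"
proof -
  have act: "active (Neq (Upair t s))" using assms active_commute(2) by blast
  have "s \<in> G" "t \<in> G" using active_good[OF assms] by (auto simp: trms_lit_def)
  moreover have "s \<noteq> t" using active_Neq_irrefl assms by blast
  ultimately show ?thesis using gt_total[of s t] active_Neq_oriented[OF _ assms] active_Neq_oriented[OF _ act] by auto
qed

text \<open>Constraints are e-free, hence true in the extension exactly when true in the given
  model; only active literals then need to be true.\<close>

lemma holds_J:
  assumes "K \<in> S"
  shows "holds J \<tau> K"
proof -
  obtain L C where K: "K = L \<parallel> C" by (cases K)
  have "sat_eqn J \<tau> q \<longleftrightarrow> sat_eqn I \<sigma> q" if "q \<in> C" for q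
    using good_S[OF assms] that K by (cases q) (auto simp: good_def trm_val_J_e_free)
  moreover have "sat J \<tau> (qf_of_lit L)" if "active L"
  proof (cases L)
    case (Eq q)
    then show ?thesis
    proof (cases q)
      case (Upair s t)
      have act: "active (Eq (Upair s t))" "active (Eq (Upair t s))"
        using that active_commute(1)[of s t] unfolding Eq Upair by blast+
      have "trm_val J \<tau> s = trm_val J \<tau> t"
        using gt_total[of s t] active_Eq_oriented[OF _ act(1)] active_Eq_oriented[OF _ act(2)]
          active_in_G[OF act(1)] by auto
      then show ?thesis using Eq Upair by simp
    qed
  next
    case (Neq q)
    then show ?thesis using that active_Neq by (cases q) auto
  next
    case Bot
    then show ?thesis using active_e_free[OF that] by (simp add: e_free_lit_def trms_lit_def)
  qed
  ultimately show ?thesis using assms K by (auto simp: holds_def active_def)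
qed

end

section \<open>From the model extension to the cover property\<close>

theorem theorem2:
  fixes \<Sigma> :: "'f signature" and e y :: "'v::infinite set"
    and gt :: "('f, 'v) trm \<Rightarrow> ('f, 'v) trm \<Rightarrow> bool"
    and \<phi> :: "('f, 'v) lit list" and \<psi> :: "('f, 'v) qf"
  assumes "finite e" and "finite y" and "e \<inter> y = {}"
    and "ground_reduction_ordering (ground_trms \<Sigma> e y) gt"
    and "orients_flat_eqns (ground_trms \<Sigma> e y) e gt"
    and "primitive_e_flat \<Sigma> e y \<phi>"
    and "algorithm_output e gt \<phi> \<psi>"
  shows "is_cover TYPE('a::infinite) \<Sigma> e y (big_and (map qf_of_lit \<phi>)) \<psi>"
proof -
  interpret flat_calculus \<Sigma> e y gt by unfold_locales (fact assms)+
  let ?S0 = "{L \<parallel> {} | L. L \<in> set \<phi>}"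
  obtain S Ks Fs where steps: "(step e gt)\<^sup>*\<^sup>* ?S0 S" and sat: "saturated e gt S"
      and Ks: "set Ks = {K \<in> S. e_free_clit e K}" and Fs: "list_all2 is_clause_qf Ks Fs"
      and \<psi>: "\<psi> = big_and Fs"
    using assms(7) unfolding algorithm_output_def by blast
  have good0: "\<forall>K \<in> ?S0. good K"
    using assms(6) by (auto simp: primitive_e_flat_def good_def)
  have good: "\<forall>K \<in> S. good K" using steps_preserve[OF steps good0] by blast
  have transfer: "(\<forall>K \<in> S. holds I \<sigma> K) \<longleftrightarrow> sat I \<sigma> (big_and (map qf_of_lit \<phi>))"
    for I :: "'f \<Rightarrow> 'c list \<Rightarrow> 'c" and \<sigma>
    using steps_preserve[OF steps good0, of I \<sigma>] by (auto simp: sat_big_and holds_def)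
  have clause: "\<exists>K \<in> set Ks. is_clause_qf K F" if "F \<in> set Fs" for F
    using Fs that by (metis in_set_conv_nth list_all2_conv_all_nth)
  have clause': "\<exists>F \<in> set Fs. is_clause_qf K F" if "K \<in> set Ks" for K
    using Fs that by (metis in_set_conv_nth list_all2_conv_all_nth)
  have sat_\<psi>: "sat I \<sigma> \<psi> \<longleftrightarrow> (\<forall>K \<in> S. e_free_clit e K \<longrightarrow> holds I \<sigma> K)"
    for I :: "'f \<Rightarrow> 'c list \<Rightarrow> 'c" and \<sigma>
    using clause clause' Ks sat_is_clause_qf unfolding \<psi> sat_big_and by blast
  have wf_vars: "wf_qf \<Sigma> F \<and> vars_qf F \<subseteq> y" if F: "F \<in> set Fs" for F
  proof -
    obtain K where K: "K \<in> S" "e_free_clit e K" "is_clause_qf K F" using clause F Ks by blast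
    then obtain qs where qs: "set qs = cnstr K" "F = Imp (big_and (map Atom qs)) (qf_of_lit (lit K))"
      by (auto simp: is_clause_qf_def)
    have wf_y: "wf_trm \<Sigma> t \<and> vars t \<subseteq> y" if "t \<in> G" "e_free e t" for t
      using that by (auto simp: ground_trms_def e_free_def)
    have "\<forall>q \<in> cnstr K. \<forall>t \<in> set_uprod q. wf_trm \<Sigma> t \<and> vars t \<subseteq> y"
      using good K wf_y unfolding good_def by blast
    moreover have "\<forall>q \<in> eqns_lit (lit K). \<forall>t \<in> set_uprod q. wf_trm \<Sigma> t \<and> vars t \<subseteq> y"
      using good K wf_y unfolding good_def e_free_lit_def trms_lit_def by blast
    ultimately show ?thesis using qs
      by (cases "lit K") (fastforce simp: wf_qf_big_and vars_qf_big_and vars_eqn_def)+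
  qed
  \<comment> \<open>The carrier is left out: truth depends on \<open>I\<close> and
    \<open>\<sigma>\<close> alone, and the extension has all of \<open>'a + 'v\<close> as its
    carrier.\<close>
  have extend: "sat I \<sigma> \<theta>"
    if \<theta>: "vars_qf \<theta> \<inter> e = {}" "valid TYPE('a) \<Sigma> (Imp (big_and (map qf_of_lit \<phi>)) \<theta>)"
      and model: "sat I \<sigma> \<psi>" for \<theta> and I :: "'f \<Rightarrow> 'a list \<Rightarrow> 'a" and \<sigma>
  proof -
    interpret N: saturated_model \<Sigma> e y gt S I \<sigma>
      by unfold_locales (use good sat sat_\<psi> model in auto)
    have "sat N.J N.\<tau> (big_and (map qf_of_lit \<phi>))" using transfer N.holds_J by blast
    moreover have "sat N.J N.\<tau> (Imp (big_and (map qf_of_lit \<phi>)) \<theta>)"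
      \<comment> \<open>Validity is assumed over subsets of \<open>'a\<close>, but the extension
        lives on the larger type \<open>'a + 'v\<close>.\<close>
      using \<theta>(2) by (rule valid_all_universes[where D = UNIV]) (auto simp: is_structure_def)
    ultimately show ?thesis using N.sat_J_e_free \<theta>(1) by simp
  qed
  have "wf_qf \<Sigma> \<psi>" "vars_qf \<psi> \<subseteq> y" using wf_vars unfolding \<psi> wf_qf_big_and vars_qf_big_and by auto
  moreover have "valid TYPE('a) \<Sigma> (Imp (big_and (map qf_of_lit \<phi>)) \<psi>)"
    unfolding valid_def sat.simps sat_\<psi> transfer[symmetric] by blast
  moreover have "valid TYPE('a) \<Sigma> (Imp \<psi> \<theta>)"
    if "vars_qf \<theta> \<inter> e = {}" "valid TYPE('a) \<Sigma> (Imp (big_and (map qf_of_lit \<phi>)) \<theta>)" for \<theta>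
    unfolding valid_def[of \<Sigma> "Imp \<psi> \<theta>"] sat.simps using extend[OF that] by blast
  ultimately show ?thesis unfolding is_cover_def by blast
qed

end
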